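(* Let $n\ge 2$. The singular pure braid group $SP_n$ is generated by the elements $a_{ij}, b_{ij}$, $1\le i<j\le n$, and is defined (as a group presentation on these generators) by the following relations, where $\varepsilon=\pm1$ and the indices range over all values in $\{1,\dots,n\}$ satisfying the indicated conditions and such that every generator $a_{pq}$ or $b_{pq}$ occurring in the relation has $p<q$: (1) $a_{ij}b_{ij}=b_{ij}a_{ij}$; (2) $a_{ik}^{-\varepsilon}a_{kj}a_{ik}^{\varepsilon}=(a_{ij}a_{kj})^{\varepsilon}a_{kj}(a_{ij}a_{kj})^{-\varepsilon}$; (3) $a_{ik}^{-\varepsilon}b_{kj}a_{ik}^{\varepsilon}=(a_{ij}a_{kj})^{\varepsilon}b_{kj}(a_{ij}a_{kj})^{-\varepsilon}$; (4) $a_{km}^{-\varepsilon}a_{kj}a_{km}^{\varepsilon}=(a_{kj}a_{mj})^{\varepsilon}a_{kj}(a_{kj}a_{mj})^{-\varepsilon}$ for $m<j$; (5) $a_{km}^{-\varepsilon}b_{kj}a_{km}^{\varepsilon}=(a_{kj}a_{mj})^{\varepsilon}b_{kj}(a_{kj}a_{mj})^{-\varepsilon}$ for $m<j$; (6) $a_{im}^{-\varepsilon}a_{kj}a_{im}^{\varepsilon}=[a_{ij}^{-\varepsilon},a_{mj}^{-\varepsilon}]^{\varepsilon}a_{kj}[a_{ij}^{-\varepsilon},a_{mj}^{-\varepsilon}]^{-\varepsilon}$ for $i<k<m$; (7) $a_{im}^{-\varepsilon}b_{kj}a_{im}^{\varepsilon}=[a_{ij}^{-\varepsilon},a_{mj}^{-\varepsilon}]^{\varepsilon}b_{kj}[a_{ij}^{-\varepsilon},a_{mj}^{-\varepsilon}]^{-\varepsilon}$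 for $i<k<m$; (8) $a_{im}^{-\varepsilon}a_{kj}a_{im}^{\varepsilon}=a_{kj}$ for $k<i<m<j$ or $m<k$; (9) $a_{im}^{-\varepsilon}b_{kj}a_{im}^{\varepsilon}=b_{kj}$ for $k<i<m<j$ or $m<k$; (10) $b_{im}^{-\varepsilon}a_{kj}b_{im}^{\varepsilon}=a_{kj}$ for $k<i<m<j$ or $m<k$; (11) $b_{im}^{-\varepsilon}b_{kj}b_{im}^{\varepsilon}=b_{kj}$ for $k<i<m<j$ or $m<k$; (12) $b_{ij}^{-\varepsilon}(a_{ik}a_{jk})b_{ij}^{\varepsilon}=a_{ik}a_{jk}$ for $i<j<k$; (13) $b_{im}^{-\varepsilon}(a_{mj}^{-1}a_{kj}a_{mj})b_{im}^{\varepsilon}=a_{mj}^{-1}a_{kj}a_{mj}$ for $i<k<m$; (14) $b_{im}^{-\varepsilon}(a_{mj}^{-1}b_{kj}a_{mj})b_{im}^{\varepsilon}=a_{mj}^{-1}b_{kj}a_{mj}$ for $i<k<m$.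
   Context: The singular braid group $SG_n$ ($n\ge2$) is the group generated by $\sigma_1,\dots,\sigma_{n-1},\tau_1,\dots,\tau_{n-1}$ with defining relations: $\sigma_i\sigma_{i+1}\sigma_i=\sigma_{i+1}\sigma_i\sigma_{i+1}$ ($1\le i\le n-2$); $\sigma_i\sigma_j=\sigma_j\sigma_i$, $\tau_i\tau_j=\tau_j\tau_i$, $\tau_i\sigma_j=\sigma_j\tau_i$ for $|i-j|\ge2$; $\tau_i\sigma_i=\sigma_i\tau_i$ ($1\le i\le n-1$); $\sigma_i\sigma_{i+1}\tau_i=\tau_{i+1}\sigma_i\sigma_{i+1}$ and $\sigma_{i+1}\sigma_i\tau_{i+1}=\tau_i\sigma_{i+1}\sigma_i$ ($1\le i\le n-2$). The singular pure braid group $SP_n$ is the kernel of the homomorphism $\pi:SG_n\to S_n$ with $\pi(\sigma_i)=\pi(\tau_i)=(i,i+1)$ for all $i$. The elements $a_{ij},b_{ij}\in SP_n$ ($1\le i<j\le n$) are $a_{i,i+1}=\sigma_i^2$, $b_{i,i+1}=\tau_i\sigma_i$, and for $i+1<j\le n$, $$a_{ij}=\sigma_{j-1}\sigma_{j-2}\cdots\sigma_{i+1}\,a_{i,i+1}\,\sigma_{i+1}^{-1}\cdots\sigma_{j-2}^{-1}\sigma_{j-1}^{-1},\qquad b_{ij}=\sigma_{j-1}\sigma_{j-2}\cdots\sigma_{i+1}\,b_{i,i+1}\,\sigma_{i+1}^{-1}\cdots\sigma_{j-2}^{-1}\sigma_{j-1}^{-1}.$$ Commutator convention: $[a,b]=a^{-1}b^{-1}ab$.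 *)

theory Defs
  imports "HOL-Algebra.Sym_Groups"
begin

section \<open>Group presentations\<close>

text \<open>A letter \<open>(x, True)\<close> stands for the generator \<open>x\<close>, a letter \<open>(x, False)\<close> for its inverse.\<close>

type_synonym 'x gword = "('x \<times> bool) list"

definition words :: "'x set \<Rightarrow> 'x gword set"
  where "words X = lists (X \<times> UNIV)"

definition winv :: "'x gword \<Rightarrow> 'x gword"
  where "winv w = rev (map (\<lambda>(x, b). (x, \<not> b)) w)"

definition wpow :: "'x gword \<Rightarrow> int \<Rightarrow> 'x gword"  (infixr \<open>\<up>\<close> 80)
  where "w \<up> k = (if 0 \<le> k then concat (replicate (nat k) w)
                   else concat (replicate (nat (- k)) (winv w)))"

definition wcomm :: "'x gword \<Rightarrow> 'x gword \<Rightarrow> 'x gword"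
  where "wcomm u v = winv u @ winv v @ u @ v"

text \<open>The least congruence on the words over \<open>X\<close> that allows free cancellation and contains
  the relations \<open>R\<close>; a relation \<open>u = v\<close> is given as the pair \<open>(u, v)\<close>.\<close>

inductive pres_eq :: "'x set \<Rightarrow> ('x gword \<times> 'x gword) set \<Rightarrow> 'x gword \<Rightarrow> 'x gword \<Rightarrow> bool"
  for X :: "'x set" and R :: "('x gword \<times> 'x gword) set"
  where
    refl: "u \<in> words X \<Longrightarrow> pres_eq X R u u"
  | sym: "pres_eq X R u v \<Longrightarrow> pres_eq X R v u"
  | trans: "pres_eq X R u v \<Longrightarrow> pres_eq X R v w \<Longrightarrow> pres_eq X R u w"
  | append: "pres_eq X R u u' \<Longrightarrow> pres_eq X R v v' \<Longrightarrow> pres_eq X R (u @ v) (u' @ v')"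
  | cancel: "x \<in> X \<Longrightarrow> pres_eq X R [(x, b), (x, \<not> b)] []"
  | rel: "(u, v) \<in> R \<Longrightarrow> u \<in> words X \<Longrightarrow> v \<in> words X \<Longrightarrow> pres_eq X R u v"

definition pres_rel :: "'x set \<Rightarrow> ('x gword \<times> 'x gword) set \<Rightarrow> ('x gword \<times> 'x gword) set"
  where "pres_rel X R = {(u, v). pres_eq X R u v}"

definition wclass :: "'x set \<Rightarrow> ('x gword \<times> 'x gword) set \<Rightarrow> 'x gword \<Rightarrow> 'x gword set"
  where "wclass X R w = pres_rel X R `` {w}"

definition presented_group ::
    "'x set \<Rightarrow> ('x gword \<times> 'x gword) set \<Rightarrow> 'x gword set monoid"
  where "presented_group X R =
    \<lparr> carrier = words X // pres_rel X R,
      mult = (\<lambda>A B. \<Union>u\<in>A. \<Union>v\<in>B. wclass X R (u @ v)),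
      one = wclass X R [] \<rparr>"

text \<open>\<open>G\<close> is presented by the relations \<open>R\<close> on the generators \<open>g x\<close>, \<open>x \<in> X\<close>: the assignment
  \<open>x \<mapsto> g x\<close> induces an isomorphism from the abstractly presented group onto \<open>G\<close>.\<close>

definition has_presentation ::
    "('g, 'm) monoid_scheme \<Rightarrow> 'x set \<Rightarrow> ('x \<Rightarrow> 'g) \<Rightarrow> ('x gword \<times> 'x gword) set \<Rightarrow> bool"
  where "has_presentation G X g R \<longleftrightarrow>
    group G \<and> (\<exists>\<phi> \<in> iso (presented_group X R) G. \<forall>x\<in>X. \<phi> (wclass X R [(x, True)]) = g x)"

definition weval :: "('g, 'm) monoid_scheme \<Rightarrow> ('x \<Rightarrow> 'g) \<Rightarrow> 'x gword \<Rightarrow> 'g"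
  where "weval G f w =
    foldr (\<lambda>(x, b) y. (if b then f x else inv\<^bsub>G\<^esub> f x) \<otimes>\<^bsub>G\<^esub> y) w \<one>\<^bsub>G\<^esub>"

text \<open>The homomorphism out of a presented group induced by \<open>f\<close>. The representative does not
  matter when \<open>f\<close> respects the relations, see \<open>pres_lift\<close> below.\<close>

definition pres_lift :: "('g, 'm) monoid_scheme \<Rightarrow> ('x \<Rightarrow> 'g) \<Rightarrow> 'x gword set \<Rightarrow> 'g"
  where "pres_lift G f A = weval G f (SOME w. w \<in> A)"

lemma words_simps [simp]:
  "[] \<in> words X"
  "(p # w) \<in> words X \<longleftrightarrow> fst p \<in> X \<and> w \<in> words X"
  "(u @ v) \<in> words X \<longleftrightarrow> u \<in> words X \<and> v \<in> words X"
  by (cases p; auto simp: words_def)+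

lemma winv_words [simp]: "winv w \<in> words X \<longleftrightarrow> w \<in> words X"
  by (force simp: words_def winv_def)

lemma pres_eq_words:
  assumes "pres_eq X R u v" shows "u \<in> words X" "v \<in> words X"
  using assms by (induction) auto

lemma equiv_pres_rel: "equiv (words X) (pres_rel X R)"
  by (rule equivI)
    (auto simp: pres_rel_def refl_on_def sym_def trans_def
      dest: pres_eq_words intro: pres_eq.intros(1-3))

lemma wclass_eq_iff:
  "u \<in> words X \<Longrightarrow> v \<in> words X \<Longrightarrow> wclass X R u = wclass X R v \<longleftrightarrow> pres_eq X R u v"
  using eq_equiv_class_iff[OF equiv_pres_rel] by (simp add: wclass_def pres_rel_def)

lemma in_wclass [simp]: "v \<in> wclass X R u \<longleftrightarrow> pres_eq X R u v"
  by (simp add: wclass_def pres_rel_def)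

lemma presented_group_carrier: "carrier (presented_group X R) = wclass X R ` words X"
  by (auto simp: presented_group_def quotient_def wclass_def)

lemma presented_group_one: "\<one>\<^bsub>presented_group X R\<^esub> = wclass X R []"
  by (simp add: presented_group_def)

lemma presented_group_mult:
  assumes "u \<in> words X" "v \<in> words X"
  shows "wclass X R u \<otimes>\<^bsub>presented_group X R\<^esub> wclass X R v = wclass X R (u @ v)"
proof -
  have "wclass X R (u' @ v') = wclass X R (u @ v)"
    if "pres_eq X R u u'" "pres_eq X R v v'" for u' v'
    using that pres_eq_words[OF that(1)] pres_eq_words[OF that(2)]
    by (simp add: wclass_eq_iff pres_eq.sym pres_eq.append)
  then show ?thesis
    using assms by (auto simp: presented_group_def set_eq_iff intro: pres_eq.refl)
qed

lemma pres_eq_winv: "w \<in> words X \<Longrightarrow> pres_eq X R (winv w @ w) []"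
proof (induction w)
  case Nil
  then show ?case by (simp add: winv_def pres_eq.refl)
next
  case (Cons p w)
  obtain x b where p: "p = (x, b)" by fastforce
  have w: "w \<in> words X" and x: "x \<in> X" using Cons.prems p by auto
  have "pres_eq X R [(x, \<not> b), (x, b)] []"
    using pres_eq.cancel[OF x, of R "\<not> b"] by simp
  then have "pres_eq X R (winv w @ ([(x, \<not> b), (x, b)] @ w)) (winv w @ ([] @ w))"
    using w by (intro pres_eq.append pres_eq.refl) auto
  then show ?case
    using Cons.IH[OF w] by (auto simp: p winv_def intro: pres_eq.trans)
qed

lemma group_presented_group: "group (presented_group X R)"
proof (rule groupI)
  fix A assume "A \<in> carrier (presented_group X R)"
  then obtain w where w: "w \<in> words X" "A = wclass X R w"
    by (auto simp: presented_group_carrier)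
  then show "\<exists>B\<in>carrier (presented_group X R).
      B \<otimes>\<^bsub>presented_group X R\<^esub> A = \<one>\<^bsub>presented_group X R\<^esub>"
    by (intro bexI[of _ "wclass X R (winv w)"])
      (simp_all add: presented_group_mult presented_group_one wclass_eq_iff pres_eq_winv
        presented_group_carrier)
qed (auto simp: presented_group_carrier presented_group_mult presented_group_one)

context group begin

lemma weval_closed:
  "f \<in> X \<rightarrow> carrier G \<Longrightarrow> w \<in> words X \<Longrightarrow> weval G f w \<in> carrier G"
  by (induction w) (auto simp: weval_def Pi_iff split: prod.split)

lemma weval_append:
  assumes "f \<in> X \<rightarrow> carrier G" "u \<in> words X" "v \<in> words X"
  shows "weval G f (u @ v) = weval G f u \<otimes> weval G f v"
  using assms(2)
proof (induction u)
  case Nil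
  then show ?case using weval_closed[OF assms(1,3)] by (simp add: weval_def)
next
  case (Cons p u)
  then have "weval G f u \<in> carrier G" using weval_closed[OF assms(1)] by simp
  moreover have "weval G f (q # w) =
      (if snd q then f (fst q) else inv f (fst q)) \<otimes> weval G f w" for q w
    by (simp add: weval_def split: prod.split)
  ultimately show ?case
    using Cons assms(1) weval_closed[OF assms(1,3)] by (auto simp: m_assoc Pi_iff)
qed

lemma weval_pres_eq:
  assumes f: "f \<in> X \<rightarrow> carrier G"
    and R: "\<And>u v. (u, v) \<in> R \<Longrightarrow> weval G f u = weval G f v"
    and "pres_eq X R u v"
  shows "weval G f u = weval G f v"
  using assms(3)
proof (induction)
  case (append u u' v v')
  then show ?case using weval_append[OF f] pres_eq_words by metis
next
  case (cancel x b)
  then show ?case using f by (auto simp: weval_def Pi_iff)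
qed (use R in auto)

lemma pres_lift:
  assumes f: "f \<in> X \<rightarrow> carrier G"
    and R: "\<And>u v. (u, v) \<in> R \<Longrightarrow> weval G f u = weval G f v"
  shows "w \<in> words X \<Longrightarrow> pres_lift G f (wclass X R w) = weval G f w"
    and "pres_lift G f \<in> hom (presented_group X R) G"
    and "x \<in> X \<Longrightarrow> pres_lift G f (wclass X R [(x, True)]) = f x"
proof -
  show *: "pres_lift G f (wclass X R w) = weval G f w" if "w \<in> words X" for w
  proof -
    have "pres_eq X R w (SOME w'. w' \<in> wclass X R w)"
      using someI[of "\<lambda>w'. w' \<in> wclass X R w" w] that by (simp add: pres_eq.refl)
    from weval_pres_eq[OF f R this] show ?thesis by (simp add: pres_lift_def)
  qed
  show "pres_lift G f \<in> hom (presented_group X R) G"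
    by (auto simp: hom_def presented_group_carrier presented_group_mult * weval_append[OF f]
        weval_closed[OF f])
  show "pres_lift G f (wclass X R [(x, True)]) = f x" if "x \<in> X"
    using f that by (auto simp: * weval_def Pi_iff)
qed

end

section \<open>The singular braid group\<close>

datatype sg_gen = SgSigma nat | SgTau nat

abbreviation sigma_w :: "nat \<Rightarrow> sg_gen gword"  (\<open>\<sigma>\<close>)
  where "\<sigma> i \<equiv> [(SgSigma i, True)]"

abbreviation tau_w :: "nat \<Rightarrow> sg_gen gword"  (\<open>\<tau>\<close>)
  where "\<tau> i \<equiv> [(SgTau i, True)]"

definition sg_gens :: "nat \<Rightarrow> sg_gen set"
  where "sg_gens n = SgSigma ` {1..<n} \<union> SgTau ` {1..<n}"

inductive_set sg_rels :: "nat \<Rightarrow> (sg_gen gword \<times> sg_gen gword) set"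
  for n :: nat
  where
    braid: "1 \<le> i \<Longrightarrow> i + 2 \<le> n \<Longrightarrow>
      (\<sigma> i @ \<sigma> (i+1) @ \<sigma> i, \<sigma> (i+1) @ \<sigma> i @ \<sigma> (i+1)) \<in> sg_rels n"
  | sigma_sigma: "i \<in> {1..<n} \<Longrightarrow> j \<in> {1..<n} \<Longrightarrow> i + 2 \<le> j \<or> j + 2 \<le> i \<Longrightarrow>
      (\<sigma> i @ \<sigma> j, \<sigma> j @ \<sigma> i) \<in> sg_rels n"
  | tau_tau: "i \<in> {1..<n} \<Longrightarrow> j \<in> {1..<n} \<Longrightarrow> i + 2 \<le> j \<or> j + 2 \<le> i \<Longrightarrow>
      (\<tau> i @ \<tau> j, \<tau> j @ \<tau> i) \<in> sg_rels n"
  | tau_sigma: "i \<in> {1..<n} \<Longrightarrow> j \<in> {1..<n} \<Longrightarrow> i + 2 \<le> j \<or> j + 2 \<le> i \<Longrightarrow>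
      (\<tau> i @ \<sigma> j, \<sigma> j @ \<tau> i) \<in> sg_rels n"
  | tau_sigma_same: "i \<in> {1..<n} \<Longrightarrow> (\<tau> i @ \<sigma> i, \<sigma> i @ \<tau> i) \<in> sg_rels n"
  | slide_up: "1 \<le> i \<Longrightarrow> i + 2 \<le> n \<Longrightarrow>
      (\<sigma> i @ \<sigma> (i+1) @ \<tau> i, \<tau> (i+1) @ \<sigma> i @ \<sigma> (i+1)) \<in> sg_rels n"
  | slide_down: "1 \<le> i \<Longrightarrow> i + 2 \<le> n \<Longrightarrow>
      (\<sigma> (i+1) @ \<sigma> i @ \<tau> (i+1), \<tau> i @ \<sigma> (i+1) @ \<sigma> i) \<in> sg_rels n"

definition SG :: "nat \<Rightarrow> sg_gen gword set monoid"
  where "SG n = presented_group (sg_gens n) (sg_rels n)"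

definition sg_elem :: "nat \<Rightarrow> sg_gen gword \<Rightarrow> sg_gen gword set"
  where "sg_elem n w = wclass (sg_gens n) (sg_rels n) w"

primrec sg_transp :: "sg_gen \<Rightarrow> nat \<Rightarrow> nat"
  where
    "sg_transp (SgSigma i) = transpose i (i+1)"
  | "sg_transp (SgTau i) = transpose i (i+1)"

definition sg_perm :: "nat \<Rightarrow> sg_gen gword set \<Rightarrow> nat \<Rightarrow> nat"
  where "sg_perm n = pres_lift (sym_group n) sg_transp"

lemma group_SG: "group (SG n)"
  by (simp add: SG_def group_presented_group)

lemma sg_transp_closed: "sg_transp \<in> sg_gens n \<rightarrow> carrier (sym_group n)"
  by (auto simp: sg_gens_def sym_group_carrier intro!: permutes_swap_id)

lemma sg_transp_rels:
  assumes "(u, v) \<in> sg_rels n"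
  shows "weval (sym_group n) sg_transp u = weval (sym_group n) sg_transp v"
  using assms
  by cases (auto simp: weval_def sym_group_mult sym_group_one fun_eq_iff transpose_def)

lemma sg_perm_hom: "sg_perm n \<in> hom (SG n) (sym_group n)"
  using group.pres_lift(2)[OF sym_group_is_group sg_transp_closed sg_transp_rels]
  by (simp add: SG_def sg_perm_def)

lemma sg_perm_gens:
  assumes "i \<in> {1..<n}"
  shows "sg_perm n (sg_elem n (\<sigma> i)) = transpose i (i+1)"
    and "sg_perm n (sg_elem n (\<tau> i)) = transpose i (i+1)"
  using assms group.pres_lift(3)[OF sym_group_is_group sg_transp_closed sg_transp_rels]
  by (simp_all add: sg_perm_def sg_elem_def sg_gens_def)

section \<open>The singular pure braid group\<close>

definition SP :: "nat \<Rightarrow> sg_gen gword set monoid"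
  where "SP n = SG n \<lparr> carrier := kernel (SG n) (sym_group n) (sg_perm n) \<rparr>"

lemma group_SP: "group (SP n)"
proof -
  interpret group_hom "SG n" "sym_group n" "sg_perm n"
    by (simp add: group_hom_def group_hom_axioms_def group_SG sym_group_is_group sg_perm_hom)
  show ?thesis
    unfolding SP_def by (rule subgroup.subgroup_is_group[OF subgroup_kernel group_SG])
qed

datatype sp_gen = SpA nat nat | SpB nat nat

definition conj_word :: "nat \<Rightarrow> nat \<Rightarrow> sg_gen gword \<Rightarrow> sg_gen gword"
  where "conj_word i j w =
    map (\<lambda>k. (SgSigma k, True)) (rev [i+1..<j]) @ w @ map (\<lambda>k. (SgSigma k, False)) [i+1..<j]"

primrec sp_word :: "sp_gen \<Rightarrow> sg_gen gword"
  where
    "sp_word (SpA i j) = conj_word i j (\<sigma> i @ \<sigma> i)"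
  | "sp_word (SpB i j) = conj_word i j (\<tau> i @ \<sigma> i)"

definition sp_elem :: "nat \<Rightarrow> sp_gen \<Rightarrow> sg_gen gword set"
  where "sp_elem n x = sg_elem n (sp_word x)"

abbreviation ix :: "nat \<Rightarrow> nat \<Rightarrow> nat \<Rightarrow> bool"
  where "ix n p q \<equiv> 1 \<le> p \<and> p < q \<and> q \<le> n"

definition sp_gens :: "nat \<Rightarrow> sp_gen set"
  where "sp_gens n = {SpA i j |i j. ix n i j} \<union> {SpB i j |i j. ix n i j}"

abbreviation a_w :: "nat \<Rightarrow> nat \<Rightarrow> sp_gen gword"  (\<open>\<alpha>\<close>)
  where "\<alpha> i j \<equiv> [(SpA i j, True)]"

abbreviation b_w :: "nat \<Rightarrow> nat \<Rightarrow> sp_gen gword"  (\<open>\<beta>\<close>)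
  where "\<beta> i j \<equiv> [(SpB i j, True)]"

text \<open>Each rule assumes \<open>ix n p q\<close> for precisely the index pairs of the generators
  occurring in it.\<close>

inductive_set sp_rels :: "nat \<Rightarrow> (sp_gen gword \<times> sp_gen gword) set"
  for n :: nat
  where
    r1: "ix n i j \<Longrightarrow> (\<alpha> i j @ \<beta> i j, \<beta> i j @ \<alpha> i j) \<in> sp_rels n"
  | r2: "\<epsilon> \<in> {1, -1} \<Longrightarrow> ix n i k \<Longrightarrow> ix n k j \<Longrightarrow> ix n i j \<Longrightarrow>
      (\<alpha> i k \<up> (-\<epsilon>) @ \<alpha> k j @ \<alpha> i k \<up> \<epsilon>,
       (\<alpha> i j @ \<alpha> k j) \<up> \<epsilon> @ \<alpha> k j @ (\<alpha> i j @ \<alpha> k j) \<up> (-\<epsilon>)) \<in> sp_rels n"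
  | r3: "\<epsilon> \<in> {1, -1} \<Longrightarrow> ix n i k \<Longrightarrow> ix n k j \<Longrightarrow> ix n i j \<Longrightarrow>
      (\<alpha> i k \<up> (-\<epsilon>) @ \<beta> k j @ \<alpha> i k \<up> \<epsilon>,
       (\<alpha> i j @ \<alpha> k j) \<up> \<epsilon> @ \<beta> k j @ (\<alpha> i j @ \<alpha> k j) \<up> (-\<epsilon>)) \<in> sp_rels n"
  | r4: "\<epsilon> \<in> {1, -1} \<Longrightarrow> ix n k m \<Longrightarrow> ix n k j \<Longrightarrow> ix n m j \<Longrightarrow> m < j \<Longrightarrow>
      (\<alpha> k m \<up> (-\<epsilon>) @ \<alpha> k j @ \<alpha> k m \<up> \<epsilon>,
       (\<alpha> k j @ \<alpha> m j) \<up> \<epsilon> @ \<alpha> k j @ (\<alpha> k j @ \<alpha> m j) \<up> (-\<epsilon>)) \<in> sp_rels n"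
  | r5: "\<epsilon> \<in> {1, -1} \<Longrightarrow> ix n k m \<Longrightarrow> ix n k j \<Longrightarrow> ix n m j \<Longrightarrow> m < j \<Longrightarrow>
      (\<alpha> k m \<up> (-\<epsilon>) @ \<beta> k j @ \<alpha> k m \<up> \<epsilon>,
       (\<alpha> k j @ \<alpha> m j) \<up> \<epsilon> @ \<beta> k j @ (\<alpha> k j @ \<alpha> m j) \<up> (-\<epsilon>)) \<in> sp_rels n"
  | r6: "\<epsilon> \<in> {1, -1} \<Longrightarrow> ix n i m \<Longrightarrow> ix n k j \<Longrightarrow> ix n i j \<Longrightarrow> ix n m j \<Longrightarrow> i < k \<Longrightarrow> k < m \<Longrightarrow>
      (\<alpha> i m \<up> (-\<epsilon>) @ \<alpha> k j @ \<alpha> i m \<up> \<epsilon>,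
       wcomm (\<alpha> i j \<up> (-\<epsilon>)) (\<alpha> m j \<up> (-\<epsilon>)) \<up> \<epsilon> @ \<alpha> k j @
       wcomm (\<alpha> i j \<up> (-\<epsilon>)) (\<alpha> m j \<up> (-\<epsilon>)) \<up> (-\<epsilon>)) \<in> sp_rels n"
  | r7: "\<epsilon> \<in> {1, -1} \<Longrightarrow> ix n i m \<Longrightarrow> ix n k j \<Longrightarrow> ix n i j \<Longrightarrow> ix n m j \<Longrightarrow> i < k \<Longrightarrow> k < m \<Longrightarrow>
      (\<alpha> i m \<up> (-\<epsilon>) @ \<beta> k j @ \<alpha> i m \<up> \<epsilon>,
       wcomm (\<alpha> i j \<up> (-\<epsilon>)) (\<alpha> m j \<up> (-\<epsilon>)) \<up> \<epsilon> @ \<beta> k j @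
       wcomm (\<alpha> i j \<up> (-\<epsilon>)) (\<alpha> m j \<up> (-\<epsilon>)) \<up> (-\<epsilon>)) \<in> sp_rels n"
  | r8: "\<epsilon> \<in> {1, -1} \<Longrightarrow> ix n i m \<Longrightarrow> ix n k j \<Longrightarrow> k < i \<and> i < m \<and> m < j \<or> m < k \<Longrightarrow>
      (\<alpha> i m \<up> (-\<epsilon>) @ \<alpha> k j @ \<alpha> i m \<up> \<epsilon>, \<alpha> k j) \<in> sp_rels n"
  | r9: "\<epsilon> \<in> {1, -1} \<Longrightarrow> ix n i m \<Longrightarrow> ix n k j \<Longrightarrow> k < i \<and> i < m \<and> m < j \<or> m < k \<Longrightarrow>
      (\<alpha> i m \<up> (-\<epsilon>) @ \<beta> k j @ \<alpha> i m \<up> \<epsilon>, \<beta> k j) \<in> sp_rels n"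
  | r10: "\<epsilon> \<in> {1, -1} \<Longrightarrow> ix n i m \<Longrightarrow> ix n k j \<Longrightarrow> k < i \<and> i < m \<and> m < j \<or> m < k \<Longrightarrow>
      (\<beta> i m \<up> (-\<epsilon>) @ \<alpha> k j @ \<beta> i m \<up> \<epsilon>, \<alpha> k j) \<in> sp_rels n"
  | r11: "\<epsilon> \<in> {1, -1} \<Longrightarrow> ix n i m \<Longrightarrow> ix n k j \<Longrightarrow> k < i \<and> i < m \<and> m < j \<or> m < k \<Longrightarrow>
      (\<beta> i m \<up> (-\<epsilon>) @ \<beta> k j @ \<beta> i m \<up> \<epsilon>, \<beta> k j) \<in> sp_rels n"
  | r12: "\<epsilon> \<in> {1, -1} \<Longrightarrow> ix n i j \<Longrightarrow> ix n i k \<Longrightarrow> ix n j k \<Longrightarrow> i < j \<Longrightarrow> j < k \<Longrightarrow>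
      (\<beta> i j \<up> (-\<epsilon>) @ (\<alpha> i k @ \<alpha> j k) @ \<beta> i j \<up> \<epsilon>, \<alpha> i k @ \<alpha> j k) \<in> sp_rels n"
  | r13: "\<epsilon> \<in> {1, -1} \<Longrightarrow> ix n i m \<Longrightarrow> ix n m j \<Longrightarrow> ix n k j \<Longrightarrow> i < k \<Longrightarrow> k < m \<Longrightarrow>
      (\<beta> i m \<up> (-\<epsilon>) @ (\<alpha> m j \<up> (-1) @ \<alpha> k j @ \<alpha> m j) @ \<beta> i m \<up> \<epsilon>,
       \<alpha> m j \<up> (-1) @ \<alpha> k j @ \<alpha> m j) \<in> sp_rels n"
  | r14: "\<epsilon> \<in> {1, -1} \<Longrightarrow> ix n i m \<Longrightarrow> ix n m j \<Longrightarrow> ix n k j \<Longrightarrow> i < k \<Longrightarrow> k < m \<Longrightarrow>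
      (\<beta> i m \<up> (-\<epsilon>) @ (\<alpha> m j \<up> (-1) @ \<beta> k j @ \<alpha> m j) @ \<beta> i m \<up> \<epsilon>,
       \<alpha> m j \<up> (-1) @ \<beta> k j @ \<alpha> m j) \<in> sp_rels n"

end

(* Write x for a or b. The relations are equivalent to a symmetric list of commutations (the
   locale sp_family): a_ij with x_ij; for i < j < k, x_ij with a_ik a_jk, x_ik with a_jk a_ij and
   x_jk with a_ij a_ik; for i < j < k < l, x_ij with y_kl, x_il with y_jk, and
   a_kl x_ik a_kl^-1 with y_jl. Conjugation by sigma_s acts on the generators by a simple rule
   (twist): the index s becomes s + 1, the index s + 1 becomes s up to conjugation by a_{s,s+1},
   and x_{s,s+1} is fixed. This rule preserves the list of commutations, so it defines
   automorphisms theta_s of the presented group P, and these satisfy the braid relations and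
   theta_s^2 = conjugation by a_{s,s+1}.

   Injectivity of P -> SG_n: think of a pair (g, q) with g in P and q^-1 a permutation as g times
   the positive lift of q^-1. Then sigma_s acts by
   (g, q) -> (theta_s(g) e, q o (s s+1)) with e = 1 if q s < q (s+1) and e = a_{s,s+1} otherwise,
   and tau_s sigma_s acts as left multiplication by b_{s,s+1}. This is an action of SG_n
   in which the image of g in P acts as left multiplication by g.

   Generation: the subgroup N of SG_n generated by all a_ij, b_ij is normal, and in SG_n / N the
   images of sigma_s and tau_s coincide and satisfy the Coxeter relations of the symmetric group,
   so N is the whole kernel. *)

theory Submission
  imports Defs "HOL-Algebra.Bij"
begin

text \<open>Apart from (1), the defining relations have the shape p^-1 y p = m y m^-1 or p^-1 y p =
  y, and the first says that p m commutes with y; this is how they become commutations. In (6) and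
  (7) the product of a_im with the commutator collapses to a_mj a_im a_mj^-1. The original list is
  lopsided: that b_ij commutes with a_ik a_jk is relation (12), whereas for a_ij it has to be
  deduced from (2) and (4). The maps theta_s satisfy the braid relations, but their squares are
  inner and need not be trivial, so they give no action of the symmetric group on P and no
  semidirect product to compare with SG_n. The factor e in the action is the correcting cocycle: it
  records when a product of positive lifts fails to be a positive lift. Both kinds of relations are
  axiomatised as locales. The commutation list is instantiated in P, for its twists and in SG_n; the
  braid relations are instantiated in SG_n and in the group of bijections of the pairs (g, q).
  Working with tau_s sigma_s in place of tau_s lets a and b share one proof, selected by a
  boolean.\<close>

context group begin

text \<open>\<open>cj\<close> conjugates from the left, so that \<open>cj (g \<otimes> h)\<close> is
  \<open>cj g\<close> after \<open>cj h\<close>; the relations of the presentation conjugate from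
  the right.\<close>

definition com :: "'a \<Rightarrow> 'a \<Rightarrow> bool"
  where "com x y \<longleftrightarrow> x \<otimes> y = y \<otimes> x"

definition cj :: "'a \<Rightarrow> 'a \<Rightarrow> 'a"
  where "cj g x = g \<otimes> x \<otimes> inv g"

lemma cancel_simps [simp]:
  assumes "x \<in> carrier G" "y \<in> carrier G"
  shows "inv x \<otimes> (x \<otimes> y) = y" "x \<otimes> (inv x \<otimes> y) = y"
  using assms by (simp_all add: m_assoc[symmetric])

lemmas word_simps = m_assoc inv_mult_group

lemma com_sym: "com x y \<Longrightarrow> com y x"
  by (simp add: com_def)

lemma com_refl: "com x x"
  by (simp add: com_def)

lemma cj_closed [simp]: "g \<in> carrier G \<Longrightarrow> x \<in> carrier G \<Longrightarrow> cj g x \<in> carrier G"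
  by (simp add: cj_def)

lemma cj_mult [simp]:
  "g \<in> carrier G \<Longrightarrow> h \<in> carrier G \<Longrightarrow> x \<in> carrier G \<Longrightarrow> cj (g \<otimes> h) x = cj g (cj h x)"
  by (simp add: cj_def word_simps)

lemma cj_one [simp]: "x \<in> carrier G \<Longrightarrow> cj \<one> x = x" "x \<in> carrier G \<Longrightarrow> cj x \<one> = \<one>"
  by (simp_all add: cj_def)

lemma cj_m:
  "g \<in> carrier G \<Longrightarrow> x \<in> carrier G \<Longrightarrow> y \<in> carrier G \<Longrightarrow> cj g (x \<otimes> y) = cj g x \<otimes> cj g y"
  by (simp add: cj_def word_simps)

lemma cj_inv [simp]:
  assumes "g \<in> carrier G" "x \<in> carrier G"
  shows "cj (inv g) (cj g x) = x" "cj g (cj (inv g) x) = x"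
  using assms by (simp_all add: cj_def word_simps)

lemma cj_cancel:
  assumes "g \<in> carrier G" "x \<in> carrier G" "y \<in> carrier G"
  shows "cj g x = cj g y \<longleftrightarrow> x = y"
  using assms by (metis cj_inv(1))

lemma com_iff_cj: "g \<in> carrier G \<Longrightarrow> x \<in> carrier G \<Longrightarrow> com g x \<longleftrightarrow> cj g x = x"
  unfolding com_def cj_def by (metis inv_solve_right m_closed)

lemma cj_cj:
  assumes "g \<in> carrier G" "h \<in> carrier G" "x \<in> carrier G"
  shows "cj (cj g h) x = cj g (cj h (cj (inv g) x))"
  using assms by (simp add: cj_def word_simps)

lemma cj_cj_cj:
  assumes "g \<in> carrier G" "h \<in> carrier G" "x \<in> carrier G"
  shows "cj (cj g h) (cj g x) = cj g (cj h x)"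
  using assms by (simp add: cj_cj)

lemma com_cj:
  assumes "g \<in> carrier G" "x \<in> carrier G" "y \<in> carrier G"
  shows "com (cj g x) (cj g y) \<longleftrightarrow> com x y"
  using assms by (simp add: com_iff_cj cj_cj_cj cj_cancel)

lemma com_mult:
  assumes "com x z" "com y z" "x \<in> carrier G" "y \<in> carrier G" "z \<in> carrier G"
  shows "com (x \<otimes> y) z"
  using assms by (simp add: com_iff_cj)

lemma com_mult_cancel:
  assumes "com (x \<otimes> y) z" "com x z" "x \<in> carrier G" "y \<in> carrier G" "z \<in> carrier G"
  shows "com y z"
  using assms by (simp add: com_iff_cj) (metis cj_cancel cj_closed)

lemma cj_comm:
  assumes "com g h" "g \<in> carrier G" "h \<in> carrier G" "x \<in> carrier G"
  shows "cj g (cj h x) = cj h (cj g x)"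
  using assms by (metis cj_mult com_def)

lemma com_cj_intro:
  assumes "com y x" "com y g" "g \<in> carrier G" "x \<in> carrier G" "y \<in> carrier G"
  shows "com y (cj g x)"
  using assms by (metis com_cj com_iff_cj com_sym)

lemma com_conj:
  assumes "com g y" "g \<in> carrier G" "y \<in> carrier G"
  shows "inv g \<otimes> (y \<otimes> g) = y" "g \<otimes> (y \<otimes> inv g) = y"
proof -
  show "inv g \<otimes> (y \<otimes> g) = y"
    using assms by (metis cancel_simps(1) com_def)
  show "g \<otimes> (y \<otimes> inv g) = y"
    using assms by (simp add: m_assoc[symmetric]) (simp add: com_def m_assoc)
qed

text \<open>Conjugating y by p m changes nothing, so conjugation by m undoes conjugation by p. With
  p and m in either role this gives the relations for both signs of the exponent.\<close>

lemma conj_eq_conj: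
  assumes "com (p \<otimes> m) y" "p \<in> carrier G" "m \<in> carrier G" "y \<in> carrier G"
  shows "inv p \<otimes> (y \<otimes> p) = m \<otimes> (y \<otimes> inv m)"
    "m \<otimes> (y \<otimes> inv m) = inv p \<otimes> (y \<otimes> p)"
proof -
  have "cj p (cj m y) = y"
    using assms by (simp add: com_iff_cj)
  then have "cj (inv p) y = cj m y"
    using assms by (metis cj_closed cj_inv(1))
  then show "inv p \<otimes> (y \<otimes> p) = m \<otimes> (y \<otimes> inv m)"
    using assms by (simp add: cj_def m_assoc)
  then show "m \<otimes> (y \<otimes> inv m) = inv p \<otimes> (y \<otimes> p)" by simp
qed

text \<open>The hypothesis reads u v = g^-1 v g u. With g = a_im, u = a_ij, v = a_mj the left side
  is the commutator of (6) and (7) for exponent 1, and multiplying it by g leaves a single conjugate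
  of g.\<close>

lemma commutator_eq1:
  assumes "com (g \<otimes> u) v" "g \<in> carrier G" "u \<in> carrier G" "v \<in> carrier G"
  shows "u \<otimes> (v \<otimes> (inv u \<otimes> inv v)) = inv g \<otimes> cj v g"
proof -
  have "g \<otimes> (u \<otimes> v) = v \<otimes> (g \<otimes> u)"
    using assms by (simp add: com_def m_assoc)
  then have "u \<otimes> v = inv g \<otimes> (v \<otimes> (g \<otimes> u))"
    using assms by (metis cancel_simps(1) m_closed)
  then have "(u \<otimes> v) \<otimes> (inv u \<otimes> inv v) = inv g \<otimes> (v \<otimes> (g \<otimes> u)) \<otimes> (inv u \<otimes> inv v)"
    by simp
  then show ?thesis
    using assms by (simp add: cj_def m_assoc)
qed

text \<open>The counterpart for exponent -1: here the hypothesis is u v g = v g u, and g^-1 times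
  the left side is the inverse of a conjugate of g.\<close>

lemma commutator_eq2:
  assumes "com (v \<otimes> g) u" "g \<in> carrier G" "u \<in> carrier G" "v \<in> carrier G"
  shows "inv v \<otimes> (inv u \<otimes> (v \<otimes> u)) = g \<otimes> inv (cj (inv u) g)"
proof -
  have "u \<otimes> (v \<otimes> g) = v \<otimes> (g \<otimes> u)"
    using assms by (simp add: com_def m_assoc)
  then have "v \<otimes> g = inv u \<otimes> (v \<otimes> (g \<otimes> u))"
    using assms by (metis cancel_simps(1) m_closed)
  then have "inv v \<otimes> (v \<otimes> g) \<otimes> (inv u \<otimes> (inv g \<otimes> u)) =
      inv v \<otimes> (inv u \<otimes> (v \<otimes> (g \<otimes> u))) \<otimes> (inv u \<otimes> (inv g \<otimes> u))"
    by simp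
  then show ?thesis
    using assms by (simp add: cj_def word_simps)
qed

end

section \<open>The symmetric list of commutations and the relations it implies\<close>

primrec sp_val :: "(bool \<Rightarrow> nat \<Rightarrow> nat \<Rightarrow> 'a) \<Rightarrow> sp_gen \<Rightarrow> 'a"
  where
    "sp_val x (SpA i j) = x True i j"
  | "sp_val x (SpB i j) = x False i j"

text \<open>\<open>True\<close> selects a and \<open>False\<close> selects b. For i < j < k the
  three \<open>tri\<close> axioms are one statement under the cyclic order ij, ik, jk: each x
  commutes with the product of the two a's that follow it. \<open>closed\<close> ranges over all
  indices, so instances need a default value outside 1 \<le> i < j \<le> n.\<close>

locale sp_family = group G for G (structure) +
  fixes n :: nat and x :: "bool \<Rightarrow> nat \<Rightarrow> nat \<Rightarrow> 'a"
  assumes closed [simp]: "x u i j \<in> carrier G"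
    and same: "ix n i j \<Longrightarrow> com (x True i j) (x u i j)"
    and tri_low: "\<lbrakk>ix n i j; ix n j k\<rbrakk> \<Longrightarrow> com (x True i k \<otimes> x True j k) (x u i j)"
    and tri_mid: "\<lbrakk>ix n i j; ix n j k\<rbrakk> \<Longrightarrow> com (x True j k \<otimes> x True i j) (x u i k)"
    and tri_high: "\<lbrakk>ix n i j; ix n j k\<rbrakk> \<Longrightarrow> com (x True i j \<otimes> x True i k) (x u j k)"
    and apart: "\<lbrakk>ix n i j; ix n k l; j < k\<rbrakk> \<Longrightarrow> com (x u i j) (x v k l)"
    and nested: "\<lbrakk>ix n i l; ix n j k; i < j; k < l\<rbrakk> \<Longrightarrow> com (x u i l) (x v j k)"
    and crossed: "\<lbrakk>ix n i j; ix n j k; ix n k l\<rbrakk> \<Longrightarrow> com (cj (x True k l) (x u i k)) (x v j l)"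
begin

lemma cj_same [simp]: "ix n i j \<Longrightarrow> cj (x True i j) (x u i j) = x u i j"
  using same by (simp add: com_iff_cj)

lemma cj_low: "\<lbrakk>ix n i j; ix n j k\<rbrakk> \<Longrightarrow> cj (x True i k) (cj (x True j k) (x u i j)) = x u i j"
  using tri_low by (simp add: com_iff_cj)

lemma cj_mid: "\<lbrakk>ix n i j; ix n j k\<rbrakk> \<Longrightarrow> cj (x True j k) (cj (x True i j) (x u i k)) = x u i k"
  using tri_mid by (simp add: com_iff_cj)

lemma cj_high: "\<lbrakk>ix n i j; ix n j k\<rbrakk> \<Longrightarrow> cj (x True i j) (cj (x True i k) (x u j k)) = x u j k"
  using tri_high by (simp add: com_iff_cj)

lemma rot1:
  assumes "ix n i j" "ix n j k"
  shows "x True i j \<otimes> (x True i k \<otimes> x True j k) = x True i k \<otimes> (x True j k \<otimes> x True i j)"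
  using tri_low[OF assms, of True] by (simp add: com_def m_assoc)

lemma rot2:
  assumes "ix n i j" "ix n j k"
  shows "x True j k \<otimes> (x True i j \<otimes> x True i k) = x True i k \<otimes> (x True j k \<otimes> x True i j)"
  using tri_mid[OF assms, of True] by (simp add: com_def m_assoc)

lemma sp_val_closed: "sp_val x \<in> UNIV \<rightarrow> carrier G"
proof
  show "sp_val x z \<in> carrier G" for z by (cases z) auto
qed

text \<open>The product a_ij a_ik a_jk is the full twist of three strands. Its cyclic rotations
  agree, so it can be rotated until the a belonging to the given x comes first or last; that a and
  the remaining two factors each commute with x.\<close>

lemma com_full:
  assumes "ix n i j" "ix n j k"
  shows "com (x True i j \<otimes> (x True i k \<otimes> x True j k)) (x u i j)"
    "com (x True i j \<otimes> (x True i k \<otimes> x True j k)) (x u i k)"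
    "com (x True i j \<otimes> (x True i k \<otimes> x True j k)) (x u j k)"
proof -
  show "com (x True i j \<otimes> (x True i k \<otimes> x True j k)) (x u i j)"
    using assms by (intro com_mult same tri_low) auto
  have "com (x True i k \<otimes> (x True j k \<otimes> x True i j)) (x u i k)"
    using assms by (intro com_mult[of "x True i k"] same tri_mid) auto
  then show "com (x True i j \<otimes> (x True i k \<otimes> x True j k)) (x u i k)"
    unfolding rot1[OF assms] .
  have "com ((x True i j \<otimes> x True i k) \<otimes> x True j k) (x u j k)"
    using assms by (intro com_mult[of "x True i j \<otimes> x True i k"] same tri_high) auto
  then show "com (x True i j \<otimes> (x True i k \<otimes> x True j k)) (x u j k)"
    by (simp add: m_assoc)
qed

text \<open>The same element with a_ij split off on the right, as required by the relations with
  exponent -1.\<close>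

lemma com_full':
  assumes "ix n i j" "ix n j k"
  shows "com ((x True i k \<otimes> x True j k) \<otimes> x True i j) (x u i k)"
    "com ((x True i k \<otimes> x True j k) \<otimes> x True i j) (x u j k)"
  using com_full(2,3)[OF assms, of u] by (simp_all add: rot1[OF assms] m_assoc)

text \<open>Conjugating \<open>crossed\<close> by the inverse of a_kl moves the conjugation to the
  other factor, which is the form of (13) and (14).\<close>

lemma crossed':
  assumes "ix n i j" "ix n j k" "ix n k l"
  shows "com (x u i k) (cj (inv x True k l) (x v j l))"
  using crossed[OF assms, of u v] by (metis closed cj_closed cj_inv(2) com_cj inv_closed)

lemma words_UNIV [simp]: "w \<in> words UNIV"
  by (simp add: words_def)

text \<open>For either sign, the exponent of a_im times the commutator reduces to a_mj a_im a_mj^-1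
  or its inverse, and \<open>crossed\<close> says that this element commutes with the generator with
  indices k, j.\<close>

lemma weval_commutator_rel:
  assumes \<epsilon>: "\<epsilon> \<in> {1, -1}" and ij: "ix n i k" "ix n k m" "ix n m j"
    and y: "y = (if v then \<alpha> k j else \<beta> k j)"
  shows "weval G (sp_val x) (\<alpha> i m \<up> (-\<epsilon>) @ y @ \<alpha> i m \<up> \<epsilon>) =
    weval G (sp_val x) (wcomm (\<alpha> i j \<up> (-\<epsilon>)) (\<alpha> m j \<up> (-\<epsilon>)) \<up> \<epsilon> @ y @
       wcomm (\<alpha> i j \<up> (-\<epsilon>)) (\<alpha> m j \<up> (-\<epsilon>)) \<up> (-\<epsilon>))"
proof -
  define g where "g = x True i m"
  define p where "p = x True i j"
  define q where "q = x True m j"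
  define z where "z = x v k j"
  have im: "ix n i m" "ix n m j" using ij by auto
  have c [simp]: "g \<in> carrier G" "p \<in> carrier G" "q \<in> carrier G" "z \<in> carrier G"
    by (simp_all add: g_def p_def q_def z_def)
  have wy: "weval G (sp_val x) (u @ y @ w) =
    weval G (sp_val x) u \<otimes> (z \<otimes> weval G (sp_val x) w)" for u w
    by (simp add: weval_append[OF sp_val_closed] weval_closed[OF sp_val_closed] y z_def)
      (simp add: weval_def)
  have comz: "com (cj q g) z"
    using crossed[OF ij] by (simp add: g_def q_def z_def)
  \<comment> \<open>By \<open>tri_low\<close> the product p q commutes with g, so conjugation by q
    equals conjugation by the inverse of p. This makes both signs lead to the same element.\<close>
  have eq: "cj q g = cj (inv p) g"
    using cj_low[OF im, of True] by (metis cj_closed cj_inv(1) g_def p_def q_def c closed)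
  have w1: "p \<otimes> (q \<otimes> (inv p \<otimes> inv q)) = inv g \<otimes> cj q g"
    using tri_high[OF im, of True] by (intro commutator_eq1) (simp_all add: g_def p_def q_def)
  have w2: "inv q \<otimes> (inv p \<otimes> (q \<otimes> p)) = g \<otimes> inv (cj q g)"
    unfolding eq using tri_mid[OF im, of True]
    by (intro commutator_eq2) (simp_all add: g_def p_def q_def)
  have "com (g \<otimes> (inv g \<otimes> cj q g)) z"
    using comz by simp
  from conj_eq_conj(1)[OF this]
  have A: "inv g \<otimes> (z \<otimes> g) = p \<otimes> (q \<otimes> (inv p \<otimes> (inv q \<otimes> (z \<otimes> (q \<otimes> (p \<otimes> (inv q \<otimes> inv p)))))))"
    unfolding w1[symmetric] by (simp add: word_simps)
  have "com (inv g \<otimes> (g \<otimes> inv (cj q g))) z"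
    using comz by simp (metis c cj_closed cj_inv(1) com_iff_cj inv_closed)
  from conj_eq_conj(1)[OF this]
  have B: "g \<otimes> (z \<otimes> inv g) = inv q \<otimes> (inv p \<otimes> (q \<otimes> (p \<otimes> (z \<otimes> (inv p \<otimes> (inv q \<otimes> (p \<otimes> q)))))))"
    unfolding w2[symmetric] by (simp add: word_simps)
  show ?thesis
    using \<epsilon> A B unfolding wy
    by (auto simp: weval_def wpow_def winv_def wcomm_def word_simps
        g_def[symmetric] p_def[symmetric] q_def[symmetric])
qed

lemma weval_rels:
  assumes "(p, q) \<in> sp_rels n"
  shows "weval G (sp_val x) p = weval G (sp_val x) q"
  using assms
proof cases
  case (r1 i j)
  then show ?thesis
    using same[of i j False] by (simp add: weval_def com_def)
next
  case (r2 \<epsilon> i k j)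
  then show ?thesis
    using conj_eq_conj[OF com_full(3)[of i k j True]] conj_eq_conj[OF com_full'(2)[of i k j True]]
    by (auto simp: weval_def wpow_def winv_def word_simps)
next
  case (r3 \<epsilon> i k j)
  then show ?thesis
    using conj_eq_conj[OF com_full(3)[of i k j False]] conj_eq_conj[OF com_full'(2)[of i k j False]]
    by (auto simp: weval_def wpow_def winv_def word_simps)
next
  case (r4 \<epsilon> k m j)
  then show ?thesis
    using conj_eq_conj[OF com_full(2)[of k m j True]] conj_eq_conj[OF com_full'(1)[of k m j True]]
    by (auto simp: weval_def wpow_def winv_def word_simps)
next
  case (r5 \<epsilon> k m j)
  then show ?thesis
    using conj_eq_conj[OF com_full(2)[of k m j False]] conj_eq_conj[OF com_full'(1)[of k m j False]]
    by (auto simp: weval_def wpow_def winv_def word_simps)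
next
  case (r6 \<epsilon> i m k j)
  then show ?thesis
    using weval_commutator_rel[of \<epsilon> i k m j "\<alpha> k j" True] by simp
next
  case (r7 \<epsilon> i m k j)
  then show ?thesis
    using weval_commutator_rel[of \<epsilon> i k m j "\<beta> k j" False] by simp
next
  case (r8 \<epsilon> i m k j)
  then have "com (x True i m) (x True k j)"
    using nested[of k j i m True True] apart[of i m k j True True] by (auto intro: com_sym)
  from com_conj[OF this] r8 show ?thesis
    by (auto simp: weval_def wpow_def winv_def word_simps)
next
  case (r9 \<epsilon> i m k j)
  then have "com (x True i m) (x False k j)"
    using nested[of k j i m False True] apart[of i m k j True False] by (auto intro: com_sym)
  from com_conj[OF this] r9 show ?thesis
    by (auto simp: weval_def wpow_def winv_def word_simps)
next
  case (r10 \<epsilon> i m k j)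
  then have "com (x False i m) (x True k j)"
    using nested[of k j i m True False] apart[of i m k j False True] by (auto intro: com_sym)
  from com_conj[OF this] r10 show ?thesis
    by (auto simp: weval_def wpow_def winv_def word_simps)
next
  case (r11 \<epsilon> i m k j)
  then have "com (x False i m) (x False k j)"
    using nested[of k j i m False False] apart[of i m k j False False] by (auto intro: com_sym)
  from com_conj[OF this] r11 show ?thesis
    by (auto simp: weval_def wpow_def winv_def word_simps)
next
  case (r12 \<epsilon> i j k)
  then have "com (x False i j) (x True i k \<otimes> x True j k)"
    using tri_low[of i j k False] by (auto intro: com_sym)
  from com_conj[OF this] r12 show ?thesis
    by (auto simp: weval_def wpow_def winv_def word_simps)
next
  case (r13 \<epsilon> i m j k)
  then have "com (x False i m) (cj (inv x True m j) (x True k j))"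
    by (intro crossed') auto
  from com_conj[OF this] r13 show ?thesis
    by (auto simp: weval_def wpow_def winv_def word_simps cj_def)
next
  case (r14 \<epsilon> i m j k)
  then have "com (x False i m) (cj (inv x True m j) (x False k j))"
    by (intro crossed') auto
  from com_conj[OF this] r14 show ?thesis
    by (auto simp: weval_def wpow_def winv_def word_simps cj_def)
qed

end

section \<open>From the relations of the presentation back to the commutations\<close>

context group begin

lemma com_of_conj:
  assumes "inv g \<otimes> (y \<otimes> g) = y" "g \<in> carrier G" "y \<in> carrier G"
  shows "com g y"
  using assms by (metis cancel_simps(2) com_def m_closed)

lemma com_of_conj_eq:
  assumes eq: "inv p \<otimes> (y \<otimes> p) = m \<otimes> (y \<otimes> inv m)"
    and c: "p \<in> carrier G" "m \<in> carrier G" "y \<in> carrier G"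
  shows "com (p \<otimes> m) y"
proof -
  have "cj p (cj m y) = cj p (inv p \<otimes> (y \<otimes> p))"
    using eq c by (simp add: cj_def m_assoc)
  also have "\<dots> = y"
    using c by (simp add: cj_def m_assoc)
  finally show ?thesis
    using c by (simp add: com_iff_cj)
qed

lemma com_mult_right:
  assumes "com z x" "com z y" "x \<in> carrier G" "y \<in> carrier G" "z \<in> carrier G"
  shows "com z (x \<otimes> y)"
  using com_mult[of x z y] assms com_sym by blast

lemma com_mult_cancel_right:
  assumes "com (x \<otimes> y) z" "com y z" "x \<in> carrier G" "y \<in> carrier G" "z \<in> carrier G"
  shows "com x z"
  using assms by (simp add: com_iff_cj)

end

text \<open>Each commutation is read off from instances with exponent 1. Relations (2) to (5) speak
  about the full product of three a's; the shorter products of the \<open>tri\<close> axioms come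
  from cancelling one factor.\<close>

lemma (in group) sp_family_if_rels:
  assumes c [simp]: "\<And>u i j. x u i j \<in> carrier G"
    and rels: "\<And>p q. (p, q) \<in> sp_rels n \<Longrightarrow> weval G (sp_val x) p = weval G (sp_val x) q"
  shows "sp_family G n x"
proof -
  note ws = weval_def wpow_def winv_def wcomm_def word_simps
  have same: "com (x True i j) (x u i j)" if "ix n i j" for u i j
    using rels[OF r1[of i j n]] that by (cases u) (simp_all add: com_def weval_def)
  have full_high: "com (x True i j \<otimes> (x True i k \<otimes> x True j k)) (x u j k)"
    if "ix n i j" "ix n j k" for u i j k
    using rels[OF r2[of 1 i j n k]] rels[OF r3[of 1 i j n k]] that
    by (intro com_of_conj_eq, cases u) (simp_all add: ws)
  have full_mid: "com (x True i j \<otimes> (x True i k \<otimes> x True j k)) (x u i k)"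
    if "ix n i j" "ix n j k" for u i j k
    using rels[OF r4[of 1 i j n k]] rels[OF r5[of 1 i j n k]] that
    by (intro com_of_conj_eq, cases u) (simp_all add: ws)
  have tri_low: "com (x True i k \<otimes> x True j k) (x u i j)" if "ix n i j" "ix n j k" for u i j k
  proof (cases u)
    case True
    \<comment> \<open>For a there is no direct relation: the full product commutes with a_jk and
      a_ik, hence with a_ik a_jk, and removing that right factor leaves a_ij. For b this is relation
      (12).\<close>
    have "com (x True i j \<otimes> (x True i k \<otimes> x True j k)) (x True i k \<otimes> x True j k)"
      using full_high[OF that] full_mid[OF that] by (intro com_mult_right) auto
    then have "com (x True i j) (x True i k \<otimes> x True j k)"
      by (rule com_mult_cancel_right) (auto simp: com_refl)
    then show ?thesis using True by (auto intro: com_sym)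
  next
    case False
    have "com (x False i j) (x True i k \<otimes> x True j k)"
      using rels[OF r12[of 1 i j n k]] that by (intro com_of_conj) (simp_all add: ws)
    then show ?thesis using False by (auto intro: com_sym)
  qed
  have tri_mid: "com (x True j k \<otimes> x True i j) (x u i k)" if "ix n i j" "ix n j k" for u i j k
  proof -
    have "x True i j \<otimes> (x True i k \<otimes> x True j k) = x True i k \<otimes> (x True j k \<otimes> x True i j)"
      using tri_low[OF that, of True] by (simp add: com_def m_assoc)
    with full_mid[OF that, of u] have "com (x True i k \<otimes> (x True j k \<otimes> x True i j)) (x u i k)"
      by simp
    then show ?thesis
      using that by (rule_tac com_mult_cancel[OF _ same]) auto
  qed
  have tri_high: "com (x True i j \<otimes> x True i k) (x u j k)" if "ix n i j" "ix n j k" for u i j k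
  proof -
    have "com ((x True i j \<otimes> x True i k) \<otimes> x True j k) (x u j k)"
      using full_high[OF that] by (simp add: m_assoc)
    then show ?thesis
      using that by (rule_tac com_mult_cancel_right[OF _ same]) auto
  qed
  have far: "com (x u i m) (x v k j)"
    if "ix n i m" "ix n k j" "k < i \<and> i < m \<and> m < j \<or> m < k" for u v i m k j
    using rels[OF r8[of 1 i m n k j]] rels[OF r9[of 1 i m n k j]]
      rels[OF r10[of 1 i m n k j]] rels[OF r11[of 1 i m n k j]] that
    by (intro com_of_conj, cases u; cases v) (simp_all add: ws)
  have crossed: "com (cj (x True k l) (x u i k)) (x v j l)"
    if ij: "ix n i j" "ix n j k" "ix n k l" for u v i j k l
  proof (cases u)
    case True
    have ik: "ix n i k" using ij by auto
    \<comment> \<open>Relations (6) and (7) make a_ik times this commutator commute with the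
      generator with indices j, l; the product simplifies to the conjugate in
      \<open>crossed\<close>.\<close>
    have "x True i l \<otimes> (x True k l \<otimes> (inv x True i l \<otimes> inv x True k l)) =
        inv x True i k \<otimes> cj (x True k l) (x True i k)"
      using tri_high[OF ik ij(3)] by (intro commutator_eq1) auto
    moreover have "com (x True i k \<otimes>
        (x True i l \<otimes> (x True k l \<otimes> (inv x True i l \<otimes> inv x True k l)))) (x v j l)"
      using rels[OF r6[of 1 i k n j l]] rels[OF r7[of 1 i k n j l]] ij
      by (intro com_of_conj_eq, cases v) (simp_all add: ws)
    ultimately show ?thesis using True by simp
  next
    case False
    have "com (x False i k) (cj (inv x True k l) (x v j l))"
      using rels[OF r13[of 1 i k n l j]] rels[OF r14[of 1 i k n l j]] ij
      by (intro com_of_conj, cases v) (simp_all add: ws cj_def)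
    then show ?thesis
      using False com_cj[of "x True k l" "x False i k" "cj (inv x True k l) (x v j l)"] by simp
  qed
  show ?thesis
    by unfold_locales (auto intro: same tri_low tri_mid tri_high far com_sym[OF far] crossed)
qed

text \<open>The rule is forced by conjugation with sigma_s in SG_n. A generator with one index s + 1
  is itself the sigma_s-conjugate of the one with s in that place, so conjugating it again produces
  conjugation by sigma_s^2 = a_{s,s+1}. The pair s, s + 1 is treated first because the transposition
  would reverse its order.\<close>

definition (in group) twist ::
    "nat \<Rightarrow> (bool \<Rightarrow> nat \<Rightarrow> nat \<Rightarrow> 'a) \<Rightarrow> bool \<Rightarrow> nat \<Rightarrow> nat \<Rightarrow> 'a"
  where "twist s x u p q =
    (if p = s \<and> q = s + 1 then x u p q
     else if p = s + 1 \<or> q = s + 1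
     then cj (x True s (s + 1)) (x u (transpose s (s + 1) p) (transpose s (s + 1) q))
     else x u (transpose s (s + 1) p) (transpose s (s + 1) q))"

section \<open>Twisting preserves the list of commutations\<close>

context sp_family begin

lemma twist_closed [simp]: "twist s x u p q \<in> carrier G"
  by (simp add: twist_def)

lemma twist_same: "twist s x u s (Suc s) = x u s (Suc s)"
  by (simp add: twist_def)

text \<open>No index lies strictly between s and s + 1, so a pair disjoint from them cannot cross
  them: it lies to one side or encloses them.\<close>

lemma com_adjacent:
  assumes "ix n s (Suc s)" "ix n p q" "p \<noteq> s" "p \<noteq> Suc s" "q \<noteq> s" "q \<noteq> Suc s"
  shows "com (x True s (Suc s)) (x u p q)"
proof -
  consider "q < s" | "p < s" "Suc s < q" | "Suc s < p"
    using assms by linarith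
  then show ?thesis
  proof cases
    case 1
    then show ?thesis using apart[of p q s "Suc s" u True] assms by (auto intro: com_sym)
  next
    case 2
    then show ?thesis using nested[of p q s "Suc s" u True] assms by (auto intro: com_sym)
  next
    case 3
    then show ?thesis using apart[of s "Suc s" p q True u] assms by auto
  qed
qed

text \<open>Twisting inserts conjugates into the products of the \<open>tri\<close> axioms; this
  identity and \<open>slide_high\<close> rewrite them as products of the original a's.\<close>

lemma slide_low:
  assumes "ix n i j" "ix n j k"
  shows "x True j k \<otimes> cj (x True i j) (x True i k) = x True i k \<otimes> x True j k"
proof -
  have "x True j k \<otimes> cj (x True i j) (x True i k) =
      (x True j k \<otimes> (x True i j \<otimes> x True i k)) \<otimes> inv x True i j"
    by (simp add: cj_def m_assoc)
  also have "\<dots> = x True i k \<otimes> x True j k"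
    unfolding rot2[OF assms] by (simp add: m_assoc)
  finally show ?thesis .
qed

lemma slide_high:
  assumes "ix n i j" "ix n j k"
  shows "x True i k \<otimes> cj (x True j k) (x True i j) = x True i j \<otimes> x True i k"
proof -
  have "x True i k \<otimes> cj (x True j k) (x True i j) =
      (x True i k \<otimes> (x True j k \<otimes> x True i j)) \<otimes> inv x True j k"
    by (simp add: cj_def m_assoc)
  also have "\<dots> = (x True i j \<otimes> (x True i k \<otimes> x True j k)) \<otimes> inv x True j k"
    by (simp only: rot1[OF assms])
  also have "\<dots> = x True i j \<otimes> x True i k"
    by (simp add: m_assoc)
  finally show ?thesis .
qed

lemma cj_slide_high:
  assumes "ix n i j" "ix n j k" "z \<in> carrier G"
  shows "cj (x True i k) (cj (cj (x True j k) (x True i j)) z) = cj (x True i j) (cj (x True i k) z)"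
  using slide_high[OF assms(1,2)] assms(3) by (metis cj_closed cj_mult closed)

text \<open>Since a_ij fixes x_ij, it may be inserted in front of x_ij; the conjugations then
  combine to one by a rotation of the full product a_ij a_ik a_jk.\<close>

lemma cj_rot2:
  assumes "ix n i j" "ix n j k"
  shows "cj (x True j k) (cj (cj (x True i j) (x True i k)) (x u i j)) = x u i j"
proof -
  have "cj (cj (x True i j) (x True i k)) (cj (x True i j) (x u i j)) =
      cj (x True i j) (cj (x True i k) (x u i j))"
    by (simp add: cj_cj_cj)
  then have "cj (x True j k) (cj (cj (x True i j) (x True i k)) (x u i j)) =
      cj (x True j k \<otimes> (x True i j \<otimes> x True i k)) (x u i j)"
    using assms by simp
  also have "\<dots> = cj (x True i j \<otimes> (x True i k \<otimes> x True j k)) (x u i j)"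
    by (simp only: rot1[OF assms] rot2[OF assms])
  also have "\<dots> = x u i j"
    using com_full(1)[OF assms] by (simp add: com_iff_cj)
  finally show ?thesis .
qed

text \<open>On index sets that miss s or s + 1, twisting is a relabelling followed by one
  conjugation common to all generators, so commutations carry over at once. If s + 1 occurs,
  a_{s,s+1} serves as the conjugator: generators without s and s + 1 commute with it.\<close>

lemma twist_eq_cj:
  assumes s: "ix n s (Suc s)" and I: "s \<notin> I \<or> Suc s \<notin> I"
  shows "\<exists>g\<in>carrier G. \<forall>u. \<forall>p\<in>I. \<forall>q\<in>I. ix n p q \<longrightarrow>
    twist s x u p q = cj g (x u (transpose s (Suc s) p) (transpose s (Suc s) q))"
proof (cases "Suc s \<in> I")
  case True
  then have "s \<notin> I" using I by auto
  then show ?thesis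
    using com_adjacent[OF s]
    by (intro bexI[of _ "x True s (Suc s)"])
      (auto simp: twist_def com_iff_cj transpose_def)
next
  case False
  then show ?thesis
    by (intro bexI[of _ \<one>]) (auto simp: twist_def)
qed

text \<open>The transposition of neighbouring values can reverse the order only of s and s + 1
  themselves.\<close>

lemma transpose_ix:
  assumes "ix n s (Suc s)" "s \<notin> I \<or> Suc s \<notin> I" "p \<in> I" "q \<in> I" "ix n p q"
  shows "ix n (transpose s (Suc s) p) (transpose s (Suc s) q)"
  using assms by (auto simp: transpose_def)

lemma twist:
  assumes s: "ix n s (Suc s)"
  shows "sp_family G n (twist s x)"
proof
  let ?t = "transpose s (Suc s)"
  define c where "c = x True s (Suc s)"
  have c [simp]: "c \<in> carrier G" by (simp add: c_def)
  show "twist s x u i j \<in> carrier G" for u i j by simp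
  show "com (twist s x True i j) (twist s x u i j)" if ij: "ix n i j" for u i j
  proof (cases "i = s \<and> j = Suc s")
    case True
    then show ?thesis using same[OF ij] by (simp add: twist_same)
  next
    case False
    then have I: "s \<notin> {i, j} \<or> Suc s \<notin> {i, j}" using ij by auto
    from twist_eq_cj[OF s I] ij obtain g where "g \<in> carrier G"
      "\<And>u. twist s x u i j = cj g (x u (?t i) (?t j))" by auto
    then show ?thesis using same transpose_ix[OF s I _ _ ij] by (simp add: com_cj)
  qed
  have tri: "com (twist s x True i k \<otimes> twist s x True j k) (twist s x u i j) \<and>
    com (twist s x True j k \<otimes> twist s x True i j) (twist s x u i k) \<and>
    com (twist s x True i j \<otimes> twist s x True i k) (twist s x u j k)"
    if ij: "ix n i j" and jk: "ix n j k" for u i j k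
  proof -
    \<comment> \<open>If both s and s + 1 occur among increasing indices, they occupy consecutive
      places. Only these cases need a computation.\<close>
    consider "i = s" "j = Suc s" | "j = s" "k = Suc s" | "s \<notin> {i, j, k} \<or> Suc s \<notin> {i, j, k}"
      using ij jk by fastforce
    then show ?thesis
    proof cases
      case 1
      then have tw: "twist s x u i j = x u i j" "twist s x u i k = x u j k"
        "twist s x u j k = cj (x True i j) (x u i k)" for u
        using ij jk by (auto simp: twist_def transpose_def)
      have mid: "cj (x True i j) (x True i k) \<otimes> x True i j = x True i j \<otimes> x True i k"
        by (simp add: cj_def m_assoc)
      have "x True i j \<otimes> x True j k = cj (x True i j) (x True j k \<otimes> x True i j)"
        by (simp add: cj_def m_assoc)
      then show ?thesis
        using tri_low[OF ij jk] tri_mid[OF ij jk] tri_high[OF ij jk]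
        unfolding tw by (simp add: slide_low[OF ij jk] mid com_cj del: cj_mult)
    next
      case 2
      then have tw: "twist s x u i j = x u i k" "twist s x u j k = x u j k"
        "twist s x u i k = cj (x True j k) (x u i j)" for u
        using ij jk by (auto simp: twist_def transpose_def)
      have low: "cj (x True j k) (x True i j) \<otimes> x True j k = x True j k \<otimes> x True i j"
        by (simp add: cj_def m_assoc)
      have mid: "x True j k \<otimes> x True i k = cj (x True j k) (x True i k \<otimes> x True j k)"
        by (simp add: cj_def m_assoc)
      show ?thesis
        using tri_low[OF ij jk] tri_mid[OF ij jk] tri_high[OF ij jk]
        unfolding tw by (simp add: low mid slide_high[OF ij jk] com_cj del: cj_mult)
    next
      case 3
      have ik: "ix n i k" using ij jk by simp
      from twist_eq_cj[OF s 3] ij jk ik obtain g where g: "g \<in> carrier G"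
        "\<And>u. twist s x u i j = cj g (x u (?t i) (?t j))"
        "\<And>u. twist s x u i k = cj g (x u (?t i) (?t k))"
        "\<And>u. twist s x u j k = cj g (x u (?t j) (?t k))" by auto
      have ij': "ix n (?t i) (?t j)" and jk': "ix n (?t j) (?t k)"
        using transpose_ix[OF s 3 _ _ ij] transpose_ix[OF s 3 _ _ jk] by auto
      show ?thesis
        using tri_low[OF ij' jk'] tri_mid[OF ij' jk'] tri_high[OF ij' jk'] g(1)
        unfolding g(2-4) by (simp add: cj_m[symmetric] com_cj)
    qed
  qed
  then show "ix n i j \<Longrightarrow> ix n j k \<Longrightarrow>
      com (twist s x True i k \<otimes> twist s x True j k) (twist s x u i j)"
    "ix n i j \<Longrightarrow> ix n j k \<Longrightarrow>
      com (twist s x True j k \<otimes> twist s x True i j) (twist s x u i k)"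
    "ix n i j \<Longrightarrow> ix n j k \<Longrightarrow>
      com (twist s x True i j \<otimes> twist s x True i k) (twist s x u j k)" for i j k u
    by blast+
  have four: "com (twist s x u i j) (twist s x v k l) \<and>
    com (twist s x u i l) (twist s x v j k) \<and>
    com (cj (twist s x True k l) (twist s x u i k)) (twist s x v j l)"
    if ij: "ix n i j" and jk: "ix n j k" and kl: "ix n k l" for u v i j k l
  proof -
    have ik: "ix n i k" and il: "ix n i l" and jl: "ix n j l" using ij jk kl by auto
    have apart': "com (x u i j) (x v k l)" for u v
      using ij jk kl by (intro apart) auto
    have nested': "com (x u i l) (x v j k)" for u v
      using ij jk kl by (intro nested) auto
    note crossed' = crossed[OF ij jk kl]
    consider "i = s" "j = Suc s" | "j = s" "k = Suc s" | "k = s" "l = Suc s"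
      | "s \<notin> {i, j, k, l} \<or> Suc s \<notin> {i, j, k, l}"
      using ij jk kl by fastforce
    then show ?thesis
    proof cases
      case 1
      then have tw: "twist s x u i j = x u i j" "twist s x u k l = x u k l"
        "twist s x u i l = x u j l" "twist s x u j k = cj (x True i j) (x u i k)"
        "twist s x u i k = x u j k" "twist s x u j l = cj (x True i j) (x u i l)" for u
        using ij jk kl by (auto simp: twist_def transpose_def)
      \<comment> \<open>The twisted \<open>nested\<close> is obtained from \<open>crossed\<close> by
        conjugating with a_il, which restores x_ik, and then with a_ij, which restores x_jl.\<close>
      have "com (x v j l) (cj (x True k l) (x u i k))" for u v
        using crossed' by (rule com_sym)
      then have "com (cj (x True i l) (x v j l)) (x u i k)" for u v
        by (subst cj_low[OF ik kl, symmetric]) (simp add: com_cj)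
      then have N: "com (x v j l) (cj (x True i j) (x u i k))" for u v
        by (subst cj_high[OF ij jl, symmetric]) (simp add: com_cj)
      \<comment> \<open>The twisted \<open>crossed\<close> is obtained from \<open>nested\<close>:
        conjugation by a_kl a_ik fixes x_il; after conjugating by a_ij, which commutes with a_kl,
        the factor a_ij a_ik disappears on x_jk.\<close>
      have "com (cj (x True k l) (cj (x True i k) (x u j k))) (x v i l)" for u v
        by (subst cj_mid[OF ik kl, symmetric]) (simp add: com_cj com_sym[OF nested'])
      then have "com (cj (x True i j) (cj (x True k l) (cj (x True i k) (x u j k))))
          (cj (x True i j) (x v i l))" for u v
        by (simp add: com_cj)
      then have "com (cj (x True k l) (x u j k)) (cj (x True i j) (x v i l))" for u v
        by (simp add: cj_comm[OF apart'] cj_high[OF ij jk])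
      then show ?thesis
        unfolding tw using apart' N by blast
    next
      case 2
      then have tw: "twist s x u i j = x u i k" "twist s x u k l = cj (x True j k) (x u j l)"
        "twist s x u i l = x u i l" "twist s x u j k = x u j k"
        "twist s x u i k = cj (x True j k) (x u i j)" "twist s x u j l = x u k l" for u
        using ij jk kl by (auto simp: twist_def transpose_def)
      \<comment> \<open>The twisted \<open>apart\<close> is \<open>crossed\<close> with the
        conjugation by a_kl removed from both sides. The next commutation, for the twisted
        \<open>crossed\<close>, is a conjugate of \<open>apart\<close>.\<close>
      have "com (x u i k) (cj (x True j k) (x v j l))" for u v
        using crossed'[of u v] cj_mid[OF jk kl, of v]
        by (metis closed cj_closed com_cj)
      moreover have "com (cj (x True j k) (cj (x True j l) (x u i j))) (x v k l)" for u v
        by (subst cj_high[OF jk kl, symmetric]) (simp add: com_cj apart')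
      ultimately show ?thesis
        unfolding tw using nested' by (simp add: cj_cj_cj)
    next
      case 3
      then have tw: "twist s x u i j = x u i j" "twist s x u k l = x u k l"
        "twist s x u i l = cj (x True k l) (x u i k)" "twist s x u j k = x u j l"
        "twist s x u i k = x u i l" "twist s x u j l = cj (x True k l) (x u j k)" for u
        using ij jk kl by (auto simp: twist_def transpose_def)
      \<comment> \<open>Here twisting keeps \<open>apart\<close> and exchanges \<open>nested\<close>
        and \<open>crossed\<close>, up to conjugation by a_kl.\<close>
      show ?thesis
        unfolding tw using apart' crossed' nested' by (simp add: com_cj)
    next
      case 4
      from twist_eq_cj[OF s 4] ij jk ik il jl kl obtain g where g: "g \<in> carrier G"
        "\<And>u. twist s x u i j = cj g (x u (?t i) (?t j))"
        "\<And>u. twist s x u i k = cj g (x u (?t i) (?t k))"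
        "\<And>u. twist s x u i l = cj g (x u (?t i) (?t l))"
        "\<And>u. twist s x u j k = cj g (x u (?t j) (?t k))"
        "\<And>u. twist s x u j l = cj g (x u (?t j) (?t l))"
        "\<And>u. twist s x u k l = cj g (x u (?t k) (?t l))" by auto
      have ij': "ix n (?t i) (?t j)" and jk': "ix n (?t j) (?t k)" and kl': "ix n (?t k) (?t l)"
        using transpose_ix[OF s 4 _ _ ij] transpose_ix[OF s 4 _ _ jk]
          transpose_ix[OF s 4 _ _ kl] by auto
      have il': "ix n (?t i) (?t l)"
        using ij' jk' kl' by auto
      have "com (x u (?t i) (?t j)) (x v (?t k) (?t l))"
        using jk' by (intro apart ij' kl') auto
      moreover have "com (x u (?t i) (?t l)) (x v (?t j) (?t k))"
        using ij' kl' by (intro nested il' jk') auto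
      ultimately show ?thesis
        using crossed[OF ij' jk' kl'] g(1)
        unfolding g(2-7) by (simp add: cj_cj_cj com_cj)
    qed
  qed
  show "com (twist s x u i j) (twist s x v k l)" if "ix n i j" "ix n k l" "j < k" for u v i j k l
    using four[of i j k l u v] that by auto
  show "com (twist s x u i l) (twist s x v j k)"
    if "ix n i l" "ix n j k" "i < j" "k < l" for u v i j k l
    using four[of i j k l u v] that by auto
  show "com (cj (twist s x True k l) (twist s x u i k)) (twist s x v j l)"
    if "ix n i j" "ix n j k" "ix n k l" for u v i j k l
    using four[of i j k l u v] that by auto
qed

end

lemma weval_Nil [simp]: "weval G f [] = \<one>\<^bsub>G\<^esub>"
  by (simp add: weval_def)

lemma weval_Cons:
  "weval G f (p # w) = (if snd p then f (fst p) else inv\<^bsub>G\<^esub> f (fst p)) \<otimes>\<^bsub>G\<^esub> weval G f w"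
  by (simp add: weval_def split: prod.split)

lemma weval_cong:
  assumes "\<And>z. z \<in> X \<Longrightarrow> f z = g z" "w \<in> words X"
  shows "weval G f w = weval G g w"
  using assms(2) by (induction w) (auto simp: weval_Cons assms(1))

lemma hom_weval:
  assumes "group G" "group H" "h \<in> hom G H" "f \<in> X \<rightarrow> carrier G" "w \<in> words X"
  shows "h (weval G f w) = weval H (\<lambda>z. h (f z)) w"
proof -
  interpret group_hom G H h
    using assms by (simp add: group_hom_def group_hom_axioms_def)
  show ?thesis
    using assms(5)
  proof (induction w)
    case (Cons p w)
    then have "f (fst p) \<in> carrier G" "weval G f w \<in> carrier G"
      using assms(4) G.weval_closed[OF assms(4)] by auto
    then show ?case
      using Cons by (simp add: weval_Cons)
  qed simp
qed

abbreviation wgen :: "'x set \<Rightarrow> ('x gword \<times> 'x gword) set \<Rightarrow> 'x \<Rightarrow> 'x gword set"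
  where "wgen X R z \<equiv> wclass X R [(z, True)]"

lemma wgen_closed: "wgen X R \<in> X \<rightarrow> carrier (presented_group X R)"
  by (auto simp: presented_group_carrier)

lemma wgen_inv:
  assumes "z \<in> X"
  shows "inv\<^bsub>presented_group X R\<^esub> wgen X R z = wclass X R [(z, False)]"
proof (rule group.inv_equality[OF group_presented_group])
  show "wclass X R [(z, False)] \<otimes>\<^bsub>presented_group X R\<^esub> wgen X R z = \<one>\<^bsub>presented_group X R\<^esub>"
    using assms pres_eq.cancel[of z X R False]
    by (simp add: presented_group_mult presented_group_one wclass_eq_iff)
qed (use assms in \<open>auto simp: presented_group_carrier\<close>)

lemma weval_wgen:
  assumes "w \<in> words X"
  shows "weval (presented_group X R) (wgen X R) w = wclass X R w"
  using assms
proof (induction w)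
  case Nil
  show ?case by (simp add: presented_group_one)
next
  case (Cons p w)
  obtain z b where p: "p = (z, b)" by fastforce
  have "weval (presented_group X R) (wgen X R) (p # w) =
      wclass X R [p] \<otimes>\<^bsub>presented_group X R\<^esub> wclass X R w"
    using Cons by (auto simp: weval_Cons p wgen_inv)
  also have "\<dots> = wclass X R ([p] @ w)"
    using Cons.prems by (intro presented_group_mult) auto
  finally show ?case by simp
qed

lemma presented_group_hom_eq:
  assumes "group H" "h \<in> hom (presented_group X R) H" "k \<in> hom (presented_group X R) H"
    and eq: "\<And>z. z \<in> X \<Longrightarrow> h (wgen X R z) = k (wgen X R z)"
    and g: "g \<in> carrier (presented_group X R)"
  shows "h g = k g"
proof -
  obtain w where w: "w \<in> words X" "g = weval (presented_group X R) (wgen X R) w"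
    using g by (auto simp: presented_group_carrier weval_wgen)
  note hw = hom_weval[OF group_presented_group assms(1) _ wgen_closed w(1)]
  show ?thesis
    unfolding w(2) hw[OF assms(2)] hw[OF assms(3)] using eq w(1) by (rule weval_cong)
qed

section \<open>The braid action on the presented group\<close>

text \<open>\<open>hom_eqI\<close> expresses that the x generate G in the form in which it is
  applied: identities between the maps \<open>\<theta> s\<close> can be checked on
  generators.\<close>

locale twisted_family = sp_family +
  fixes \<theta> :: "nat \<Rightarrow> 'a \<Rightarrow> 'a"
  assumes theta_hom: "\<lbrakk>1 \<le> s; s < n\<rbrakk> \<Longrightarrow> \<theta> s \<in> hom G G"
    and theta_x: "\<lbrakk>1 \<le> s; s < n; ix n p q\<rbrakk> \<Longrightarrow> \<theta> s (x u p q) = twist s x u p q"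
    and hom_eqI: "\<lbrakk>h \<in> hom G G; k \<in> hom G G;
      \<And>u i j. ix n i j \<Longrightarrow> h (x u i j) = k (x u i j); g \<in> carrier G\<rbrakk> \<Longrightarrow> h g = k g"
begin

lemma theta_group_hom: "\<lbrakk>1 \<le> s; s < n\<rbrakk> \<Longrightarrow> group_hom G G (\<theta> s)"
  using theta_hom by (simp add: group_hom_def group_hom_axioms_def group_axioms)

lemma theta_closed [simp]: "\<lbrakk>1 \<le> s; s < n; g \<in> carrier G\<rbrakk> \<Longrightarrow> \<theta> s g \<in> carrier G"
  using theta_hom by (auto simp: hom_def)

lemma theta_mult [simp]:
  "\<lbrakk>1 \<le> s; s < n; g \<in> carrier G; h \<in> carrier G\<rbrakk> \<Longrightarrow> \<theta> s (g \<otimes> h) = \<theta> s g \<otimes> \<theta> s h"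
  using theta_hom by (auto simp: hom_def)

lemma theta_one [simp]: "\<lbrakk>1 \<le> s; s < n\<rbrakk> \<Longrightarrow> \<theta> s \<one> = \<one>"
  using group_hom.hom_one[OF theta_group_hom] .

lemma theta_cj [simp]:
  "\<lbrakk>1 \<le> s; s < n; g \<in> carrier G; h \<in> carrier G\<rbrakk> \<Longrightarrow> \<theta> s (cj g h) = cj (\<theta> s g) (\<theta> s h)"
  using group_hom.hom_inv[OF theta_group_hom] by (simp add: cj_def)

lemma hom_cj: "g \<in> carrier G \<Longrightarrow> cj g \<in> hom G G"
  by (auto simp: hom_def cj_m)

lemma theta_adj: "\<lbrakk>1 \<le> s; s < n\<rbrakk> \<Longrightarrow> \<theta> s (x u s (Suc s)) = x u s (Suc s)"
  by (simp add: theta_x twist_same)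

lemma theta_simps:
  assumes "1 \<le> s" "s < n"
  shows "\<lbrakk>Suc s < q; q \<le> n\<rbrakk> \<Longrightarrow> \<theta> s (x u s q) = x u (Suc s) q"
    "\<lbrakk>Suc s < q; q \<le> n\<rbrakk> \<Longrightarrow> \<theta> s (x u (Suc s) q) = cj (x True s (Suc s)) (x u s q)"
    "\<lbrakk>1 \<le> p; p < s\<rbrakk> \<Longrightarrow> \<theta> s (x u p s) = x u p (Suc s)"
    "\<lbrakk>1 \<le> p; p < s\<rbrakk> \<Longrightarrow> \<theta> s (x u p (Suc s)) = cj (x True s (Suc s)) (x u p s)"
    "\<lbrakk>ix n p q; p \<noteq> s; p \<noteq> Suc s; q \<noteq> s; q \<noteq> Suc s\<rbrakk> \<Longrightarrow> \<theta> s (x u p q) = x u p q"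
  using assms by (auto simp: theta_x twist_def transpose_def)

lemma theta_theta:
  assumes s: "1 \<le> s" "s < n" and g: "g \<in> carrier G"
  shows "\<theta> s (\<theta> s g) = cj (x True s (Suc s)) g"
proof (rule hom_eqI[of "\<lambda>g. \<theta> s (\<theta> s g)", OF _ hom_cj _ g])
  show "(\<lambda>g. \<theta> s (\<theta> s g)) \<in> hom G G"
    using s by (auto simp: hom_def)
  fix u p q assume pq: "ix n p q"
  have ss: "ix n s (Suc s)" using s by auto
  consider "p = s" "q = Suc s" | "p = s" "Suc s < q" | "p = Suc s" "Suc s < q" | "p < s" "q = s"
    | "p < s" "q = Suc s" | "p \<noteq> s" "p \<noteq> Suc s" "q \<noteq> s" "q \<noteq> Suc s"
    using pq by linarith
  then show "\<theta> s (\<theta> s (x u p q)) = cj (x True s (Suc s)) (x u p q)"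
  proof cases
    case 6
    then show ?thesis
      using com_adjacent[OF ss pq] s pq by (simp add: theta_simps com_iff_cj)
  qed (use s pq in \<open>simp_all add: theta_simps theta_adj\<close>)
qed simp

lemma theta_far:
  assumes s: "1 \<le> s" "s + 2 \<le> t" "t < n" and g: "g \<in> carrier G"
  shows "\<theta> s (\<theta> t g) = \<theta> t (\<theta> s g)"
proof (rule hom_eqI[of "\<lambda>g. \<theta> s (\<theta> t g)", OF _ _ _ g])
  show "(\<lambda>g. \<theta> s (\<theta> t g)) \<in> hom G G" "(\<lambda>g. \<theta> t (\<theta> s g)) \<in> hom G G"
    using s by (auto simp: hom_def)
  fix u p q assume pq: "ix n p q"
  have st: "com (x True s (Suc s)) (x True t (Suc t))"
    using s by (intro apart) auto
  have st': "1 \<le> t" "s < n" using s by auto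
  have "p = s \<or> p = Suc s \<or> p = t \<or> p = Suc t \<or> (p \<noteq> s \<and> p \<noteq> Suc s \<and> p \<noteq> t \<and> p \<noteq> Suc t)"
    "q = s \<or> q = Suc s \<or> q = t \<or> q = Suc t \<or> (q \<noteq> s \<and> q \<noteq> Suc s \<and> q \<noteq> t \<and> q \<noteq> Suc t)"
    by auto
  then show "\<theta> s (\<theta> t (x u p q)) = \<theta> t (\<theta> s (x u p q))"
  proof (elim disjE)
  qed (use s st' pq in \<open>simp_all add: theta_simps theta_adj cj_comm[OF st]\<close>)
qed

text \<open>On a generator both sides become conjugates of one generator by a's on the strands s, s
  + 1, s + 2; the relations among these three a's identify them.\<close>

lemma theta_braid:
  assumes s: "1 \<le> s" "Suc s < n" and g: "g \<in> carrier G"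
  shows "\<theta> s (\<theta> (Suc s) (\<theta> s g)) = \<theta> (Suc s) (\<theta> s (\<theta> (Suc s) g))"
proof (rule hom_eqI[of "\<lambda>g. \<theta> s (\<theta> (Suc s) (\<theta> s g))", OF _ _ _ g])
  show "(\<lambda>g. \<theta> s (\<theta> (Suc s) (\<theta> s g))) \<in> hom G G"
    "(\<lambda>g. \<theta> (Suc s) (\<theta> s (\<theta> (Suc s) g))) \<in> hom G G"
    using s by (auto simp: hom_def)
  fix u p q assume pq: "ix n p q"
  have "p = s \<or> p = Suc s \<or> p = Suc (Suc s) \<or> (p \<noteq> s \<and> p \<noteq> Suc s \<and> p \<noteq> Suc (Suc s))"
    "q = s \<or> q = Suc s \<or> q = Suc (Suc s) \<or> (q \<noteq> s \<and> q \<noteq> Suc s \<and> q \<noteq> Suc (Suc s))"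
    by auto
  then show "\<theta> s (\<theta> (Suc s) (\<theta> s (x u p q))) = \<theta> (Suc s) (\<theta> s (\<theta> (Suc s) (x u p q)))"
  proof (elim disjE)
  qed (use s pq in
      \<open>simp_all add: theta_simps theta_adj cj_cj_cj cj_low cj_slide_high cj_rot2\<close>)
qed

end

section \<open>The Coxeter presentation of the symmetric group\<close>

text \<open>The generators are involutions, so words without signs suffice and \<open>square\<close>
  takes the place of free cancellation.\<close>

inductive cox_eq :: "nat \<Rightarrow> nat list \<Rightarrow> nat list \<Rightarrow> bool"
  for n :: nat
  where
    refl: "set u \<subseteq> {1..<n} \<Longrightarrow> cox_eq n u u"
  | sym: "cox_eq n u v \<Longrightarrow> cox_eq n v u"
  | trans: "cox_eq n u v \<Longrightarrow> cox_eq n v w \<Longrightarrow> cox_eq n u w"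
  | append: "cox_eq n u u' \<Longrightarrow> cox_eq n v v' \<Longrightarrow> cox_eq n (u @ v) (u' @ v')"
  | square: "i \<in> {1..<n} \<Longrightarrow> cox_eq n [i, i] []"
  | far: "i \<in> {1..<n} \<Longrightarrow> j \<in> {1..<n} \<Longrightarrow> i + 2 \<le> j \<or> j + 2 \<le> i \<Longrightarrow> cox_eq n [i, j] [j, i]"
  | braid: "1 \<le> i \<Longrightarrow> Suc i < n \<Longrightarrow> cox_eq n [i, Suc i, i] [Suc i, i, Suc i]"

definition transps :: "nat list \<Rightarrow> nat \<Rightarrow> nat"
  where "transps u = foldr (\<lambda>i f. transpose i (Suc i) \<circ> f) u id"

lemma transps_simps [simp]:
  "transps [] = id" "transps (i # u) = transpose i (Suc i) \<circ> transps u"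
  by (simp_all add: transps_def)

lemma transps_append [simp]: "transps (u @ v) = transps u \<circ> transps v"
  by (induction u) (simp_all add: o_assoc)

lemma cox_eq_transps: "cox_eq n u v \<Longrightarrow> transps u = transps v"
  by (induction rule: cox_eq.induct) (auto simp: fun_eq_iff transpose_def)

lemma cox_eq_set:
  assumes "cox_eq n u v"
  shows "set u \<subseteq> {1..<n}" "set v \<subseteq> {1..<n}"
  using assms by induction auto

lemma cox_eq_mid:
  assumes "cox_eq n v v'" "set u \<subseteq> {1..<n}" "set w \<subseteq> {1..<n}"
  shows "cox_eq n (u @ v @ w) (u @ v' @ w)"
  using assms by (intro cox_eq.append cox_eq.refl)

lemma cox_eq_far:
  assumes "i \<in> {1..<n}" "set w \<subseteq> {1..<n}" "\<And>j. j \<in> set w \<Longrightarrow> i + 2 \<le> j \<or> j + 2 \<le> i"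
  shows "cox_eq n (w @ [i]) (i # w)"
  using assms(2,3)
proof (induction w)
  case Nil
  then show ?case using assms(1) by (auto intro: cox_eq.refl)
next
  case (Cons j w)
  have "cox_eq n ([j] @ (w @ [i]) @ []) ([j] @ (i # w) @ [])"
    using Cons by (intro cox_eq_mid) auto
  moreover have "cox_eq n ([] @ [j, i] @ w) ([] @ [i, j] @ w)"
    using Cons.prems assms(1) by (intro cox_eq_mid cox_eq.far) auto
  ultimately show ?case
    by (auto intro: cox_eq.trans)
qed

text \<open>Conjugation by the cycle k ... j shifts the letter i to i - 1. In the word, i passes the
  letters below i - 1, a braid move turns i, i - 1, i into i - 1, i, i - 1, and the first i - 1
  passes the letters above i.\<close>

lemma cox_eq_move:
  assumes "1 \<le> j" "j < i" "i \<le> k" "k < n"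
  shows "cox_eq n (rev [j..<Suc k] @ [i]) ((i - 1) # rev [j..<Suc k])"
proof -
  define m where "m = i - 1"
  have i: "i = Suc m" and m: "1 \<le> m" "j \<le> m" using assms by (auto simp: m_def)
  define U V where "U = rev [Suc i..<Suc k]" and "V = rev [j..<m]"
  have "[j..<Suc k] = [j..<m] @ [m..<Suc k]"
    using upt_add_eq_append[of j m "Suc k - m"] assms i m by simp
  also have "[m..<Suc k] = m # i # [Suc i..<Suc k]"
    using assms i by (simp add: upt_conv_Cons del: upt_Suc)
  finally have eq: "rev [j..<Suc k] = U @ [i, m] @ V"
    by (simp add: U_def V_def del: upt_Suc)
  have sets: "set U \<subseteq> {1..<n}" "set V \<subseteq> {1..<n}"
    using assms i by (auto simp: U_def V_def)
  have "cox_eq n ((U @ [i, m]) @ (V @ [i]) @ []) ((U @ [i, m]) @ (i # V) @ [])"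
    using sets assms i m by (intro cox_eq_mid cox_eq_far) (auto simp: V_def)
  then have 1: "cox_eq n (U @ [i, m] @ V @ [i]) (U @ [i, m, i] @ V)"
    by simp
  have 2: "cox_eq n (U @ [i, m, i] @ V) (U @ [m, i, m] @ V)"
    using sets assms i m cox_eq.braid[of m n] by (intro cox_eq_mid) (auto intro: cox_eq.sym)
  have "cox_eq n ([] @ (U @ [m]) @ ([i, m] @ V)) ([] @ (m # U) @ ([i, m] @ V))"
    using sets assms i m by (intro cox_eq_mid cox_eq_far) (auto simp: U_def)
  then have 3: "cox_eq n (U @ [m, i, m] @ V) (m # U @ [i, m] @ V)"
    by simp
  show ?thesis
    unfolding eq m_def[symmetric] using cox_eq.trans[OF 1 cox_eq.trans[OF 2 3]] by simp
qed

text \<open>Every word in \<open>1, \<dots>, k\<close> lies in one of the right cosets \<open>W c\<close> of the words in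
  \<open>1, \<dots>, k - 1\<close>, where \<open>c = k (k - 1) \<cdots> j\<close> and the empty word is the case \<open>j = k + 1\<close>.\<close>

lemma cox_eq_coset:
  assumes "1 \<le> k" "k < n" "set u \<subseteq> {1..<Suc k}"
  shows "\<exists>v j. set v \<subseteq> {1..<k} \<and> 1 \<le> j \<and> j \<le> Suc k \<and> cox_eq n u (v @ rev [j..<Suc k])"
  using assms(3)
proof (induction u rule: rev_induct)
  case Nil
  show ?case
    using assms by (intro exI[of _ "[]"] exI[of _ "Suc k"]) (auto intro: cox_eq.refl)
next
  case (snoc i u)
  then obtain v j where v: "set v \<subseteq> {1..<k}" and j: "1 \<le> j" "j \<le> Suc k"
    and u: "cox_eq n u (v @ rev [j..<Suc k])" by auto
  have i: "1 \<le> i" "i \<le> k" "i < n" using snoc.prems assms(2) by auto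
  have vn: "set v \<subseteq> {1..<n}" using v assms by auto
  have ui: "cox_eq n (u @ [i]) (v @ rev [j..<Suc k] @ [i])"
    using cox_eq.append[OF u cox_eq.refl[of "[i]"]] i by simp
  \<comment> \<open>Appending i to the coset word k ... j: the letter passes through as i - 1,
    cancels the last letter, prolongs the word by one, or commutes with all of it. A letter that
    reaches \<open>v\<close> is below k.\<close>
  consider "j < i" | "i = j" | "j = Suc i" | "Suc i < j" by linarith
  then show ?case
  proof cases
    case 1
    then have "cox_eq n (v @ (rev [j..<Suc k] @ [i]) @ []) (v @ ((i - 1) # rev [j..<Suc k]) @ [])"
      using i j assms vn by (intro cox_eq_mid cox_eq_move) auto
    then have "cox_eq n (u @ [i]) ((v @ [i - 1]) @ rev [j..<Suc k])"
      using ui by (auto intro: cox_eq.trans)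
    moreover have "set (v @ [i - 1]) \<subseteq> {1..<k}" using v 1 i j by auto
    ultimately show ?thesis using j by blast
  next
    case 2
    then have eq: "rev [j..<Suc k] = rev [Suc j..<Suc k] @ [j]"
      using i by (simp add: upt_conv_Cons del: upt_Suc)
    have "cox_eq n ((v @ rev [Suc j..<Suc k]) @ [i, i] @ []) ((v @ rev [Suc j..<Suc k]) @ [] @ [])"
      using i j assms vn by (intro cox_eq_mid cox_eq.square) auto
    then have "cox_eq n (u @ [i]) (v @ rev [Suc j..<Suc k])"
      using ui 2 unfolding eq by (auto intro: cox_eq.trans)
    then show ?thesis using j v 2 i by (intro exI[of _ v] exI[of _ "Suc j"]) simp
  next
    case 3
    then have "rev [i..<Suc k] = rev [j..<Suc k] @ [i]"
      using i by (simp add: upt_conv_Cons del: upt_Suc)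
    then have "cox_eq n (u @ [i]) (v @ rev [i..<Suc k])"
      using ui by simp
    then show ?thesis using v i by (intro exI[of _ v] exI[of _ i]) simp
  next
    case 4
    then have "cox_eq n (v @ (rev [j..<Suc k] @ [i]) @ []) (v @ (i # rev [j..<Suc k]) @ [])"
      using i j assms vn by (intro cox_eq_mid cox_eq_far) auto
    then have "cox_eq n (u @ [i]) ((v @ [i]) @ rev [j..<Suc k])"
      using ui by (auto intro: cox_eq.trans)
    moreover have "set (v @ [i]) \<subseteq> {1..<k}" using v 4 i j by auto
    ultimately show ?thesis using j by blast
  qed
qed

lemma transps_rev_upt: "j \<le> k \<Longrightarrow> transps (rev [j..<k]) j = k"
proof (induction k rule: dec_induct)
  case (step k)
  then show ?case by simp
qed simp

lemma transps_fixes: "set u \<subseteq> {1..<k} \<Longrightarrow> transps u (Suc k) = Suc k"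
  by (induction u) (auto simp: transpose_def)

text \<open>Induction on the bound for the letters. In the coset form the factor k ... j sends j to
  k + 1 and \<open>v\<close> fixes k + 1, so a word for the identity has j = k + 1; its coset factor
  is empty and \<open>v\<close> uses fewer letters.\<close>

theorem cox_eq_Nil_if_transps:
  assumes "set u \<subseteq> {1..<n}" "transps u = id"
  shows "cox_eq n u []"
proof -
  have "cox_eq n u []" if "k \<le> n" "set u \<subseteq> {1..<k}" "transps u = id" for k u
    using that
  proof (induction k arbitrary: u)
    case 0
    then show ?case by (auto intro: cox_eq.refl)
  next
    case (Suc k)
    show ?case
    proof (cases "k = 0")
      case True
      then show ?thesis using Suc.prems by (auto intro: cox_eq.refl)
    next
      case False
      then obtain v j where v: "set v \<subseteq> {1..<k}" and j: "1 \<le> j" "j \<le> Suc k"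
        and uv: "cox_eq n u (v @ rev [j..<Suc k])"
        using cox_eq_coset[of k n u] Suc.prems by auto
      have "transps (v @ rev [j..<Suc k]) = id"
        using cox_eq_transps[OF uv] Suc.prems(3) by (simp only:)
      moreover have "transps (v @ rev [j..<Suc k]) j = Suc k"
        using transps_rev_upt[OF j(2)] transps_fixes[OF v] by simp
      ultimately have "j = Suc k" by simp
      with uv have uv: "cox_eq n u v" by simp
      then have "cox_eq n v []"
        using Suc v cox_eq_transps[OF uv] by auto
      then show ?thesis using uv by (rule cox_eq.trans[rotated])
    qed
  qed
  then show ?thesis using assms by blast
qed

section \<open>Coxeter words evaluated in a group\<close>

definition (in group) gprod :: "(nat \<Rightarrow> 'a) \<Rightarrow> nat list \<Rightarrow> 'a"
  where "gprod f u = foldr (\<lambda>i y. f i \<otimes> y) u \<one>"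

context group begin

lemma gprod_simps [simp]: "gprod f [] = \<one>" "gprod f (i # u) = f i \<otimes> gprod f u"
  by (simp_all add: gprod_def)

lemma gprod_closed: "f \<in> {1..<n} \<rightarrow> carrier G \<Longrightarrow> set u \<subseteq> {1..<n} \<Longrightarrow> gprod f u \<in> carrier G"
  by (induction u) (auto simp: Pi_iff)

lemma gprod_append:
  assumes "f \<in> {1..<n} \<rightarrow> carrier G" "set u \<subseteq> {1..<n}" "set v \<subseteq> {1..<n}"
  shows "gprod f (u @ v) = gprod f u \<otimes> gprod f v"
  using assms(2)
proof (induction u)
  case Nil
  then show ?case using gprod_closed[OF assms(1,3)] by simp
next
  case (Cons i u)
  then have "f i \<in> carrier G" "gprod f u \<in> carrier G"
    using assms(1) gprod_closed[OF assms(1), of u] by auto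
  then show ?case using Cons gprod_closed[OF assms(1,3)] by (simp add: m_assoc)
qed

lemma gprod_cox_eq:
  assumes f: "f \<in> {1..<n} \<rightarrow> carrier G"
    and sq: "\<And>i. i \<in> {1..<n} \<Longrightarrow> f i \<otimes> f i = \<one>"
    and far: "\<And>i j. 1 \<le> i \<Longrightarrow> i + 2 \<le> j \<Longrightarrow> j < n \<Longrightarrow> f i \<otimes> f j = f j \<otimes> f i"
    and br: "\<And>i. 1 \<le> i \<Longrightarrow> Suc i < n \<Longrightarrow>
      f i \<otimes> (f (Suc i) \<otimes> f i) = f (Suc i) \<otimes> (f i \<otimes> f (Suc i))"
    and "cox_eq n u v"
  shows "gprod f u = gprod f v"
  using assms(5)
proof induction
  case (append u u' v v')
  then show ?case by (metis gprod_append[OF f] cox_eq_set)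
next
  case (square i)
  then show ?case using f sq by (auto simp: Pi_iff)
next
  case (far i j)
  then have "f i \<in> carrier G" "f j \<in> carrier G" using f by auto
  then show ?case using far assms(3)[of i j] assms(3)[of j i] by auto
next
  case (braid i)
  then have "f i \<in> carrier G" "f (Suc i) \<in> carrier G" using f by auto
  then show ?case using br[OF braid] by simp
qed auto

end

section \<open>The singular braid relations\<close>

text \<open>\<open>d True i\<close> stands for sigma_i^2 and \<open>d False i\<close> for tau_i
  sigma_i. The singular generator is recovered as \<open>d False i \<otimes> inv s i\<close>, and in
  terms of \<open>d\<close> the mixed relations look the same for both kinds.\<close>

locale braid_family = group G for G (structure) +
  fixes n :: nat and s :: "nat \<Rightarrow> 'a" and d :: "bool \<Rightarrow> nat \<Rightarrow> 'a"
  assumes s_closed [simp]: "\<lbrakk>1 \<le> i; i < n\<rbrakk> \<Longrightarrow> s i \<in> carrier G"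
    and d_closed [simp]: "\<lbrakk>1 \<le> i; i < n\<rbrakk> \<Longrightarrow> d u i \<in> carrier G"
    and d_True: "\<lbrakk>1 \<le> i; i < n\<rbrakk> \<Longrightarrow> d True i = s i \<otimes> s i"
    and com_sd: "\<lbrakk>1 \<le> i; i < n\<rbrakk> \<Longrightarrow> com (s i) (d u i)"
    and far_ss: "\<lbrakk>1 \<le> i; i + 2 \<le> j; j < n\<rbrakk> \<Longrightarrow> com (s i) (s j)"
    and far_sd: "\<lbrakk>1 \<le> i; i + 2 \<le> j; j < n\<rbrakk> \<Longrightarrow> com (s i) (d u j)"
    and far_ds: "\<lbrakk>1 \<le> i; i + 2 \<le> j; j < n\<rbrakk> \<Longrightarrow> com (d u i) (s j)"
    and far_dd: "\<lbrakk>1 \<le> i; i + 2 \<le> j; j < n\<rbrakk> \<Longrightarrow> com (d u i) (d v j)"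
    and braid: "\<lbrakk>1 \<le> i; Suc i < n\<rbrakk> \<Longrightarrow>
      s i \<otimes> (s (Suc i) \<otimes> s i) = s (Suc i) \<otimes> (s i \<otimes> s (Suc i))"
    and slide_up: "\<lbrakk>1 \<le> i; Suc i < n\<rbrakk> \<Longrightarrow> cj (s i) (cj (s (Suc i)) (d u i)) = d u (Suc i)"
    and slide_down: "\<lbrakk>1 \<le> i; Suc i < n\<rbrakk> \<Longrightarrow> cj (s (Suc i)) (cj (s i) (d u (Suc i))) = d u i"

lemma (in group) com_inv_left:
  assumes "com x y" "x \<in> carrier G" "y \<in> carrier G"
  shows "com (inv x) y"
  using assms by (metis cj_inv(1) com_iff_cj inv_closed)

lemma (in group) com_inv_right:
  assumes "com y x" "x \<in> carrier G" "y \<in> carrier G"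
  shows "com y (inv x)"
  using com_inv_left[of x y] assms com_sym by blast

text \<open>Passes from the slide of e = tau_i sigma_i to that of tau_i = e a^-1. The braid relation
  in the form a b a^-1 = b^-1 a b absorbs the extra factor.\<close>

lemma (in group) slide_inverse:
  assumes "a \<otimes> (b \<otimes> a) = b \<otimes> (a \<otimes> b)" "cj a (cj b e) = e'"
    and c: "a \<in> carrier G" "b \<in> carrier G" "e \<in> carrier G"
  shows "a \<otimes> (b \<otimes> (e \<otimes> inv a)) = e' \<otimes> (inv b \<otimes> (a \<otimes> b))"
proof -
  have "a \<otimes> b = inv b \<otimes> (a \<otimes> (b \<otimes> a))"
    using assms(1) c by simp
  then have *: "a \<otimes> b \<otimes> inv a = inv b \<otimes> (a \<otimes> b)"
    using c by (simp add: m_assoc)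
  have "a \<otimes> (b \<otimes> (e \<otimes> inv a)) = cj a (cj b e) \<otimes> (a \<otimes> b \<otimes> inv a)"
    using c by (simp add: cj_def word_simps)
  then show ?thesis
    using * assms(2) by simp
qed

primrec sg_val :: "(nat \<Rightarrow> 'a) \<Rightarrow> (nat \<Rightarrow> 'a) \<Rightarrow> sg_gen \<Rightarrow> 'a"
  where
    "sg_val s t (SgSigma i) = s i"
  | "sg_val s t (SgTau i) = t i"

context braid_family begin

lemma weval_sg_rels:
  assumes "(p, q) \<in> sg_rels n"
  shows "weval G (sg_val s (\<lambda>i. d False i \<otimes> inv s i)) p =
    weval G (sg_val s (\<lambda>i. d False i \<otimes> inv s i)) q"
  using assms
proof cases
  case (braid i)
  then show ?thesis
    using braid_family.braid[OF braid_family_axioms, of i] by (simp add: weval_Cons)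
next
  case (sigma_sigma i j)
  then show ?thesis
    using far_ss[of i j] far_ss[of j i] by (auto simp: weval_Cons com_def)
next
  case (tau_tau i j)
  then have "com (d False i \<otimes> inv s i) (d False j \<otimes> inv s j)"
    by (auto intro!: com_mult com_mult_right com_inv_left com_inv_right
        intro: far_ss far_sd far_ds far_dd com_sym[OF far_ss] com_sym[OF far_ds]
          com_sym[OF far_sd] com_sym[OF far_dd])
  then show ?thesis
    using tau_tau by (auto simp: weval_Cons com_def)
next
  case (tau_sigma i j)
  then have "com (d False i \<otimes> inv s i) (s j)"
    by (auto intro!: com_mult com_inv_left
        intro: far_ss far_sd far_ds com_sym[OF far_ss] com_sym[OF far_ds] com_sym[OF far_sd])
  then show ?thesis
    using tau_sigma by (auto simp: weval_Cons com_def)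
next
  case (tau_sigma_same i)
  then have "com (d False i \<otimes> inv s i) (s i)"
    by (auto intro!: com_mult com_inv_left intro: com_sym[OF com_sd] com_refl)
  then show ?thesis
    using tau_sigma_same by (auto simp: weval_Cons com_def)
next
  case (slide_up i)
  then show ?thesis
    using slide_inverse[OF braid_family.braid[OF braid_family_axioms, of i]
        braid_family.slide_up[OF braid_family_axioms, of i False]]
    by (simp add: weval_Cons m_assoc)
next
  case (slide_down i)
  then show ?thesis
    using slide_inverse[OF braid_family.braid[OF braid_family_axioms, of i, symmetric]
        braid_family.slide_down[OF braid_family_axioms, of i False]]
    by (simp add: weval_Cons m_assoc)
qed

end

section \<open>The action on labelled permutations\<close>

lemma BijGroup_mult_app:
  "\<lbrakk>f \<in> Bij S; g \<in> Bij S; z \<in> S\<rbrakk> \<Longrightarrow> (f \<otimes>\<^bsub>BijGroup S\<^esub> g) z = f (g z)"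
  by (simp add: BijGroup_def compose_def)

lemma BijGroup_eqI:
  assumes "f \<in> carrier (BijGroup S)" "g \<in> carrier (BijGroup S)" "\<And>z. z \<in> S \<Longrightarrow> f z = g z"
  shows "f = g"
  using assms by (auto simp: BijGroup_def Bij_def intro: extensionalityI)

lemma carrier_BijGroup: "carrier (BijGroup S) = Bij S"
  by (simp add: BijGroup_def)

context twisted_family begin

text \<open>Injectivity guarantees that q i and q (i + 1) differ, so that their comparison decides
  whether a transposition lengthens or shortens.\<close>

definition states :: "('a \<times> (nat \<Rightarrow> nat)) set"
  where "states = carrier G \<times> {q. inj q}"

text \<open>If q i < q (i + 1), then sigma_i times the positive lift of q^-1 is again a positive
  lift. Otherwise that lift already begins with sigma_i, and the product is sigma_i^2 = a_{i,i+1}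
  times the lift of the shorter permutation.\<close>

definition label :: "nat \<Rightarrow> (nat \<Rightarrow> nat) \<Rightarrow> 'a"
  where "label i q = (if q i < q (Suc i) then \<one> else x True i (Suc i))"

text \<open>The restriction to \<open>states\<close> makes the function extensional, as membership
  in \<open>Bij states\<close> demands.\<close>

definition act :: "nat \<Rightarrow> 'a \<times> (nat \<Rightarrow> nat) \<Rightarrow> 'a \<times> (nat \<Rightarrow> nat)"
  where "act i = (\<lambda>(g, q)\<in>states. (\<theta> i g \<otimes> label i q, q \<circ> transpose i (Suc i)))"

definition lmul :: "'a \<Rightarrow> 'a \<times> (nat \<Rightarrow> nat) \<Rightarrow> 'a \<times> (nat \<Rightarrow> nat)"
  where "lmul g = (\<lambda>(h, q)\<in>states. (g \<otimes> h, q))"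

lemma label_closed [simp]: "label i q \<in> carrier G"
  by (simp add: label_def)

lemma states_iff [simp]: "(g, q) \<in> states \<longleftrightarrow> g \<in> carrier G \<and> inj q"
  by (simp add: states_def)

lemma inj_comp_transpose [simp]: "inj q \<Longrightarrow> inj (q \<circ> transpose i j)"
  by (simp add: inj_compose)

lemma act_app:
  "\<lbrakk>g \<in> carrier G; inj q\<rbrakk> \<Longrightarrow> act i (g, q) = (\<theta> i g \<otimes> label i q, q \<circ> transpose i (Suc i))"
  by (simp add: act_def)

lemma lmul_app: "\<lbrakk>h \<in> carrier G; inj q\<rbrakk> \<Longrightarrow> lmul g (h, q) = (g \<otimes> h, q)"
  by (simp add: lmul_def)

lemma lmul_Bij: "g \<in> carrier G \<Longrightarrow> lmul g \<in> Bij states"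
  unfolding Bij_def
  by (auto simp: lmul_def intro!: bij_betw_byWitness[where f' = "\<lambda>(h, q). (inv g \<otimes> h, q)"])

lemma lmul_hom: "lmul \<in> hom G (BijGroup states)"
proof (rule homI)
  fix g h assume gh: "g \<in> carrier G" "h \<in> carrier G"
  show "lmul g \<in> carrier (BijGroup states)"
    using gh by (simp add: carrier_BijGroup lmul_Bij)
  show "lmul (g \<otimes> h) = lmul g \<otimes>\<^bsub>BijGroup states\<^esub> lmul h"
  proof (rule BijGroup_eqI[where S = states])
    show "lmul (g \<otimes> h) z = (lmul g \<otimes>\<^bsub>BijGroup states\<^esub> lmul h) z" if "z \<in> states" for z
      using gh that by (cases z) (simp add: BijGroup_mult_app lmul_Bij lmul_app m_assoc)
    show "lmul g \<otimes>\<^bsub>BijGroup states\<^esub> lmul h \<in> carrier (BijGroup states)"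
      using gh by (intro monoid.m_closed group.is_monoid group_BijGroup)
        (simp_all add: carrier_BijGroup lmul_Bij)
  qed (use gh in \<open>simp add: carrier_BijGroup lmul_Bij\<close>)
qed

text \<open>Of two successive applications exactly one meets a descent, so a_{i,i+1} is contributed
  once; as \<open>\<theta> i\<close> squares to conjugation by it, only left multiplication
  remains.\<close>

lemma act_act:
  assumes i: "1 \<le> i" "i < n" and z: "z \<in> states"
  shows "act i (act i z) = lmul (x True i (Suc i)) z"
proof -
  obtain g q where z': "z = (g, q)" "g \<in> carrier G" "inj q"
    using z by (cases z) auto
  have ix: "ix n i (Suc i)" using i by auto
  have "q i \<noteq> q (Suc i)"
    using z'(3) by (simp_all add: inj_eq)
  then have "\<theta> i (label i q) \<otimes> label i (q \<circ> transpose i (Suc i)) = x True i (Suc i)"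
    using i by (simp add: label_def theta_adj)
  moreover have "q \<circ> transpose i (Suc i) \<circ> transpose i (Suc i) = q"
    by (simp add: fun_eq_iff)
  ultimately show ?thesis
    using i z' by (simp add: act_app lmul_app theta_theta m_assoc) (simp add: cj_def m_assoc)
qed

lemma act_closed: "\<lbrakk>1 \<le> i; i < n; z \<in> states\<rbrakk> \<Longrightarrow> act i z \<in> states"
  by (cases z) (simp add: act_app)

text \<open>The square of \<open>act i\<close> is a left multiplication, hence bijective, which
  gives injectivity and surjectivity of \<open>act i\<close>.\<close>

lemma act_Bij:
  assumes i: "1 \<le> i" "i < n"
  shows "act i \<in> Bij states"
proof -
  let ?L = "lmul (x True i (Suc i))"
  have L: "bij_betw ?L states states"
    using lmul_Bij by (auto simp: Bij_def)
  have "inj_on (act i) states"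
    using bij_betw_imp_inj_on[OF L] by (metis act_act[OF i] inj_on_def)
  moreover have "states \<subseteq> act i ` states"
  proof
    fix z assume "z \<in> states"
    then obtain y where "y \<in> states" "z = ?L y"
      using L unfolding bij_betw_def by blast
    then show "z \<in> act i ` states"
      using act_act[OF i] act_closed[OF i] by (metis imageI)
  qed
  moreover have "act i ` states \<subseteq> states"
    using act_closed[OF i] by blast
  ultimately show ?thesis
    by (simp add: Bij_def bij_betw_def subset_antisym) (simp add: act_def)
qed

lemma act_lmul:
  assumes "1 \<le> i" "i < n" "g \<in> carrier G" "z \<in> states"
  shows "act i (lmul g z) = lmul (\<theta> i g) (act i z)"
  using assms by (cases z) (simp add: act_app lmul_app m_assoc)

lemma act_far:
  assumes i: "1 \<le> i" "i + 2 \<le> j" "j < n" and z: "z \<in> states"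
  shows "act i (act j z) = act j (act i z)"
proof -
  obtain g q where z': "z = (g, q)" "g \<in> carrier G" "inj q"
    using z by (cases z) auto
  have ij: "1 \<le> j" "i < n" using i by auto
  have l: "label i (q \<circ> transpose j (Suc j)) = label i q"
    "label j (q \<circ> transpose i (Suc i)) = label j q"
    using i by (auto simp: label_def)
  have "\<theta> i (label j q) = label j q" "\<theta> j (label i q) = label i q"
    using i ij by (auto simp: label_def theta_simps)
  moreover have "com (label i q) (label j q)"
    using i ij by (auto simp: label_def com_def intro!: apart[unfolded com_def])
  moreover have "q \<circ> transpose i (Suc i) \<circ> transpose j (Suc j) =
      q \<circ> transpose j (Suc j) \<circ> transpose i (Suc i)"
    using i by (auto simp: fun_eq_iff transpose_def)
  ultimately show ?thesis
    using i ij z' theta_far[OF i] by (simp add: act_app l m_assoc com_def)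
qed

lemma act_braid:
  assumes i: "1 \<le> i" "Suc i < n" and z: "z \<in> states"
  shows "act i (act (Suc i) (act i z)) = act (Suc i) (act i (act (Suc i) z))"
proof -
  obtain g q where z': "z = (g, q)" "g \<in> carrier G" "inj q"
    using z by (cases z) auto
  let ?j = "Suc i" and ?k = "Suc (Suc i)"
  have ij: "ix n i ?j" "ix n ?j ?k" using i by auto
  have q: "q \<circ> transpose i ?j \<circ> transpose ?j ?k \<circ> transpose i ?j =
      q \<circ> transpose ?j ?k \<circ> transpose i ?j \<circ> transpose ?j ?k"
    by (auto simp: fun_eq_iff transpose_def)
  have ne: "q i \<noteq> q ?j" "q i \<noteq> q ?k" "q ?j \<noteq> q ?k"
    using z'(3) by (simp_all add: inj_eq)
  have 1: "\<theta> i (x True i ?k) = x True ?j ?k" "\<theta> ?j (x True i ?k) = cj (x True ?j ?k) (x True i ?j)"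
    "\<theta> i (x True ?j ?k) = cj (x True i ?j) (x True i ?k)" "\<theta> ?j (x True i ?j) = x True i ?k"
    "\<theta> i (x True i ?j) = x True i ?j" "\<theta> ?j (x True ?j ?k) = x True ?j ?k"
    using i ij by (simp_all add: theta_simps theta_adj)
  have 2: "cj (x True i ?j) (x True i ?k) \<otimes> x True i ?j = x True i ?j \<otimes> x True i ?k"
    by (simp add: cj_def m_assoc)
  have 3: "x True ?j ?k \<otimes> (x True i ?j \<otimes> x True i ?k) = x True i ?j \<otimes> (x True i ?k \<otimes> x True ?j ?k)"
    by (simp only: rot1[OF ij] rot2[OF ij])
  \<comment> \<open>The cocycle condition for the labels, checked for each relative order of the
    three values of q; the rotations of the full product settle the cases with several
    descents.\<close>
  have "\<theta> i (\<theta> ?j (label i q)) \<otimes> (\<theta> i (label ?j (q \<circ> transpose i ?j)) \<otimes>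
      label i (q \<circ> transpose i ?j \<circ> transpose ?j ?k)) =
    \<theta> ?j (\<theta> i (label ?j q)) \<otimes> (\<theta> ?j (label i (q \<circ> transpose ?j ?k)) \<otimes>
      label ?j (q \<circ> transpose ?j ?k \<circ> transpose i ?j))"
    using ne i by (auto simp: label_def 1 2 3 slide_low[OF ij] cj_low[OF ij])
  then show ?thesis
    using i z' by (simp add: act_app theta_braid m_assoc q)
qed

interpretation B: group "BijGroup states"
  by (rule group_BijGroup)

text \<open>Turns every mixed relation between \<open>act i\<close> and a left multiplication into
  an identity for \<open>\<theta> i\<close> in G.\<close>

lemma Bij_cj_act_lmul:
  assumes "1 \<le> i" "i < n" "g \<in> carrier G"
  shows "group.cj (BijGroup states) (act i) (lmul g) = lmul (\<theta> i g)"
proof -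
  have c: "act i \<in> carrier (BijGroup states)" "lmul g \<in> carrier (BijGroup states)"
    "lmul (\<theta> i g) \<in> carrier (BijGroup states)"
    using assms by (auto simp: carrier_BijGroup act_Bij lmul_Bij)
  have "act i \<otimes>\<^bsub>BijGroup states\<^esub> lmul g = lmul (\<theta> i g) \<otimes>\<^bsub>BijGroup states\<^esub> act i"
    using assms c by (intro BijGroup_eqI[where S = states] B.m_closed)
      (auto simp: BijGroup_mult_app act_Bij lmul_Bij act_lmul)
  then show ?thesis
    using c by (simp add: B.cj_def B.m_assoc)
qed

lemma braid_family_act:
  "braid_family (BijGroup states) n act (\<lambda>u i. lmul (x u i (Suc i)))"
proof
  have ac [simp]: "\<lbrakk>1 \<le> i; i < n\<rbrakk> \<Longrightarrow> act i \<in> carrier (BijGroup states)" for i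
    by (simp add: carrier_BijGroup act_Bij)
  have lc [simp]: "g \<in> carrier G \<Longrightarrow> lmul g \<in> carrier (BijGroup states)" for g
    by (simp add: carrier_BijGroup lmul_Bij)
  have com_lmul: "B.com (lmul g) (lmul h)" if "com g h" "g \<in> carrier G" "h \<in> carrier G" for g h
    using that hom_mult[OF lmul_hom] by (metis B.com_def com_def)
  have com_act: "B.com (act i) (lmul g)" if "\<theta> i g = g" "1 \<le> i" "i < n" "g \<in> carrier G" for i g
    using that by (simp add: B.com_iff_cj Bij_cj_act_lmul)
  have far: "B.com (act i) (act j)" if "1 \<le> i" "i + 2 \<le> j" "j < n" for i j
    unfolding B.com_def
  proof (rule BijGroup_eqI[where S = states])
    show "(act i \<otimes>\<^bsub>BijGroup states\<^esub> act j) z = (act j \<otimes>\<^bsub>BijGroup states\<^esub> act i) z"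
      if "z \<in> states" for z
      using act_far[OF \<open>1 \<le> i\<close> \<open>i + 2 \<le> j\<close> \<open>j < n\<close> that] \<open>1 \<le> i\<close> \<open>i + 2 \<le> j\<close> \<open>j < n\<close> that
      by (simp add: BijGroup_mult_app act_Bij)
  qed (use that in auto)
  fix i j :: nat and u v
  show "act i \<in> carrier (BijGroup states)" if "1 \<le> i" "i < n" using that by simp
  show "lmul (x u i (Suc i)) \<in> carrier (BijGroup states)" by simp
  show "lmul (x True i (Suc i)) = act i \<otimes>\<^bsub>BijGroup states\<^esub> act i" if "1 \<le> i" "i < n"
    using that by (intro BijGroup_eqI[where S = states] B.m_closed) (simp_all add: BijGroup_mult_app act_Bij act_act)
  show "B.com (act i) (lmul (x u i (Suc i)))" if "1 \<le> i" "i < n"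
    using that by (intro com_act) (auto simp: theta_adj)
  show "B.com (act i) (act j)" if "1 \<le> i" "i + 2 \<le> j" "j < n"
    by (rule far[OF that])
  show "B.com (act i) (lmul (x u j (Suc j)))" if "1 \<le> i" "i + 2 \<le> j" "j < n"
    using that by (intro com_act) (auto simp: theta_simps)
  show "B.com (lmul (x u i (Suc i))) (act j)" if "1 \<le> i" "i + 2 \<le> j" "j < n"
    using that by (intro B.com_sym[OF com_act]) (auto simp: theta_simps)
  show "B.com (lmul (x u i (Suc i))) (lmul (x v j (Suc j)))" if "1 \<le> i" "i + 2 \<le> j" "j < n"
    using that by (intro com_lmul apart) auto
  show "act i \<otimes>\<^bsub>BijGroup states\<^esub> (act (Suc i) \<otimes>\<^bsub>BijGroup states\<^esub> act i) =
      act (Suc i) \<otimes>\<^bsub>BijGroup states\<^esub> (act i \<otimes>\<^bsub>BijGroup states\<^esub> act (Suc i))"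
    if "1 \<le> i" "Suc i < n"
  proof (rule BijGroup_eqI[where S = states])
    have ii: "1 \<le> Suc i" "i < n" using that by auto
    note app = BijGroup_mult_app[unfolded carrier_BijGroup[symmetric]]
    show "(act i \<otimes>\<^bsub>BijGroup states\<^esub> (act (Suc i) \<otimes>\<^bsub>BijGroup states\<^esub> act i)) z =
        (act (Suc i) \<otimes>\<^bsub>BijGroup states\<^esub> (act i \<otimes>\<^bsub>BijGroup states\<^esub> act (Suc i))) z"
      if "z \<in> states" for z
      using act_braid[OF \<open>1 \<le> i\<close> \<open>Suc i < n\<close> that] that \<open>1 \<le> i\<close> \<open>Suc i < n\<close> ii
      by (simp add: app act_closed)
  qed (use that in auto)
  show "B.cj (act i) (B.cj (act (Suc i)) (lmul (x u i (Suc i)))) = lmul (x u (Suc i) (Suc (Suc i)))"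
    if "1 \<le> i" "Suc i < n"
    using that by (simp add: Bij_cj_act_lmul theta_simps)
  show "B.cj (act (Suc i)) (B.cj (act i) (lmul (x u (Suc i) (Suc (Suc i))))) = lmul (x u i (Suc i))"
    if "1 \<le> i" "Suc i < n"
    \<comment> \<open>Applying \<open>\<theta>\<close> for i and then for i + 1 yields x_{i,i+1}
      conjugated by a_{i,i+2} a_{i+1,i+2}, a conjugation that \<open>cj_low\<close> removes.\<close>
    using that cj_low[of i "Suc i" "Suc (Suc i)" u]
    by (simp add: Bij_cj_act_lmul theta_simps theta_adj)
qed

end

section \<open>The elements a_ij and b_ij inside a braid family\<close>

context braid_family begin

text \<open>The recursion runs over the gap: \<open>band u p k\<close> has upper index p + k + 1,
  and the next conjugator has exactly that index.\<close>

primrec band :: "bool \<Rightarrow> nat \<Rightarrow> nat \<Rightarrow> 'a"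
  where
    "band u p 0 = d u p"
  | "band u p (Suc k) = cj (s (Suc (p + k))) (band u p k)"

text \<open>The value \<open>\<one>\<close> outside the index range keeps every
  \<open>pure u p q\<close> in the carrier.\<close>

definition pure :: "bool \<Rightarrow> nat \<Rightarrow> nat \<Rightarrow> 'a"
  where "pure u p q = (if ix n p q then band u p (q - Suc p) else \<one>)"

lemma band_closed: "\<lbrakk>1 \<le> p; p + k < n\<rbrakk> \<Longrightarrow> band u p k \<in> carrier G"
  by (induction k) auto

lemma pure_closed [simp]: "pure u p q \<in> carrier G"
  by (auto simp: pure_def intro: band_closed)

lemma pure_adj: "\<lbrakk>1 \<le> p; p < n\<rbrakk> \<Longrightarrow> pure u p (Suc p) = d u p"
  by (simp add: pure_def)

lemma pure_Suc:
  assumes "ix n p q" "q < n"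
  shows "pure u p (Suc q) = cj (s q) (pure u p q)"
proof -
  have "Suc q - Suc p = Suc (q - Suc p)" "Suc (p + (q - Suc p)) = q"
    using assms by auto
  then show ?thesis
    using assms by (simp add: pure_def del: diff_Suc_Suc)
qed

lemma com_pure:
  assumes pq: "ix n p q" and m: "m \<in> carrier G" "com m (d u p)"
    and "\<And>k. \<lbrakk>p < k; k < q\<rbrakk> \<Longrightarrow> com m (s k)"
  shows "com m (pure u p q)"
proof -
  have "p + k < q \<Longrightarrow> com m (band u p k)" for k
    using assms by (induction k) (auto intro!: com_cj_intro band_closed)
  then show ?thesis
    using pq by (simp add: pure_def)
qed

lemma far_ss': "\<lbrakk>1 \<le> i; 1 \<le> j; i < n; j < n; i + 2 \<le> j \<or> j + 2 \<le> i\<rbrakk> \<Longrightarrow> com (s i) (s j)"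
  using far_ss[of i j] far_ss[of j i] com_sym by auto

lemma far_sd': "\<lbrakk>1 \<le> i; 1 \<le> j; i < n; j < n; i + 2 \<le> j \<or> j + 2 \<le> i\<rbrakk> \<Longrightarrow> com (s i) (d u j)"
  using far_sd[of i j] far_ds[of j i] com_sym by auto

lemma cj_s_s: "\<lbrakk>1 \<le> i; i < n; z \<in> carrier G\<rbrakk> \<Longrightarrow> cj (s i) (cj (s i) z) = cj (pure True i (Suc i)) z"
  by (simp add: pure_adj d_True)

lemma cj_outside:
  assumes "1 \<le> i" "i < n" "ix n p q" "Suc i < p \<or> q < i"
  shows "cj (s i) (pure u p q) = pure u p q"
proof -
  have "com (s i) (pure u p q)"
    using assms by (intro com_pure) (auto intro!: far_ss' far_sd')
  then show ?thesis
    using assms by (simp add: com_iff_cj)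
qed

text \<open>For q = i + 2 the braid relation moves sigma_{i+1} next to the generator with indices p,
  i, with which it commutes. Larger q only add conjugators that commute with sigma_i.\<close>

lemma cj_inside:
  assumes "ix n p i" "Suc i < q" "q \<le> n"
  shows "cj (s i) (pure u p q) = pure u p q"
proof -
  have "Suc (Suc i) \<le> q" using assms by simp
  then show ?thesis
    using assms(3)
  proof (induction q rule: dec_induct)
    case base
    have "cj (s i) (pure u p (Suc (Suc i))) = cj (s i \<otimes> (s (Suc i) \<otimes> s i)) (pure u p i)"
      using assms base by (simp add: pure_Suc)
    also have "\<dots> = cj (s (Suc i)) (cj (s i) (cj (s (Suc i)) (pure u p i)))"
      using assms base by (simp add: braid)
    also have "\<dots> = pure u p (Suc (Suc i))"
      using assms base by (simp add: cj_outside pure_Suc)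
    finally show ?case .
  next
    case (step q)
    have "com (s i) (s q)"
      using assms step by (intro far_ss) auto
    then have "cj (s i) (cj (s q) (pure u p q)) = cj (s q) (cj (s i) (pure u p q))"
      using assms step by (intro cj_comm) auto
    then show ?case
      using assms step by (simp add: pure_Suc)
  qed
qed

lemma cj_up:
  assumes "1 \<le> i" "Suc i < q" "q \<le> n"
  shows "cj (s i) (pure u i q) = pure u (Suc i) q"
proof -
  have "Suc (Suc i) \<le> q" using assms by simp
  then show ?thesis
    using assms(3)
  proof (induction q rule: dec_induct)
    case base
    then show ?case
      using assms slide_up[of i u] by (simp add: pure_Suc pure_adj)
  next
    case (step q)
    have "com (s i) (s q)"
      using assms step by (intro far_ss) auto
    then have "cj (s i) (cj (s q) (pure u i q)) = cj (s q) (cj (s i) (pure u i q))"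
      using assms step by (intro cj_comm) auto
    then show ?case
      using assms step by (simp add: pure_Suc)
  qed
qed

lemma cj_s_pure:
  assumes i: "1 \<le> i" "i < n" and pq: "ix n p q"
  shows "cj (s i) (pure u p q) = twist i pure u p q"
proof -
  consider "p = i" "q = Suc i" | "p = i" "Suc i < q" | "p = Suc i" | "p < i" "q = i"
    | "p < i" "q = Suc i" | "p < i" "Suc i < q" | "Suc i < p \<or> q < i"
    using pq by linarith
  then show ?thesis
  proof cases
    case 1
    then show ?thesis
      using i com_sd[OF i, of u] by (simp add: twist_def pure_adj com_iff_cj)
  next
    case 2
    then show ?thesis using i pq by (simp add: twist_def cj_up)
  next
    case 3
    then have "pure u p q = cj (s i) (pure u i q)"
      using i pq by (simp add: cj_up)
    then show ?thesis
      using 3 i pq by (simp add: twist_def cj_s_s)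
  next
    case 4
    then show ?thesis using i pq by (simp add: twist_def pure_Suc)
  next
    case 5
    then have "pure u p q = cj (s i) (pure u p i)"
      using i pq by (simp add: pure_Suc)
    then show ?thesis
      using 5 i pq by (simp add: twist_def cj_s_s)
  next
    case 6
    then show ?thesis using i pq by (simp add: twist_def cj_inside)
  next
    case 7
    then show ?thesis using i pq by (auto simp: twist_def cj_outside)
  qed
qed

text \<open>Conjugating a relation by \<open>s m\<close> moves the index \<open>m\<close> to \<open>Suc m\<close>, so each relation only has
  to be checked for consecutive indices.\<close>

lemma cj_shift:
  assumes "1 \<le> m" "m < n" "ix n p q" "p \<noteq> Suc m" "q \<noteq> Suc m"
  shows "cj (s m) (pure u p q) =
    pure u (if p = m then Suc m else p) (if q = m then Suc m else q)"
  using assms by (auto simp: cj_s_pure twist_def transpose_def)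

lemma com_cj_D: "com x y \<Longrightarrow> g \<in> carrier G \<Longrightarrow> x \<in> carrier G \<Longrightarrow> y \<in> carrier G \<Longrightarrow>
    com (cj g x) (cj g y)"
  by (simp add: com_cj)

lemma pure_same: "ix n p q \<Longrightarrow> com (pure True p q) (pure u p q)"
proof (induction q)
  case (Suc q)
  show ?case
  proof (cases "p = q")
    case True
    then show ?thesis
      using Suc.prems com_sd[of p u]
      by (auto simp: pure_adj d_True intro!: com_mult)
  next
    case False
    then have "ix n p q" using Suc.prems by auto
    from com_cj_D[OF Suc.IH[OF this], of "s q"] this Suc.prems show ?thesis
      by (simp add: pure_Suc)
  qed
qed simp

text \<open>With s = sigma_i and t = sigma_j the three products of a's are t s s t, t t s s and s t
  t s. Conjugation by them slides a generator to the neighbouring position and back.\<close>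

lemma pure_tri_base:
  assumes i: "1 \<le> i" "Suc i < n"
  defines "j \<equiv> Suc i"
  defines "k \<equiv> Suc (Suc i)"
  shows "com (pure True i k \<otimes> pure True j k) (pure u i j) \<and>
    com (pure True j k \<otimes> pure True i j) (pure u i k) \<and>
    com (pure True i j \<otimes> pure True i k) (pure u j k)"
proof -
  let ?s = "s i" and ?t = "s j"
  have c: "?s \<in> carrier G" "?t \<in> carrier G" "d u i \<in> carrier G" "d u j \<in> carrier G"
    using i by (auto simp: j_def)
  have up: "cj ?s (cj ?t (d u i)) = d u j" and down: "cj ?t (cj ?s (d u j)) = d u i"
    using i slide_up[OF i] slide_down[OF i] by (simp_all add: j_def)
  have br: "?s \<otimes> (?t \<otimes> ?s) = ?t \<otimes> (?s \<otimes> ?t)"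
    using braid[OF i] by (simp add: j_def)
  have fix_i: "cj ?s (d u i) = d u i" and fix_j: "cj ?t (d u j) = d u j"
    using i com_sd[of i u] com_sd[of j u] by (simp_all add: j_def com_iff_cj)
  have p: "pure v i j = d v i" "pure v j k = d v j" "pure v i k = cj ?t (d v i)"
    "d True i = ?s \<otimes> ?s" "d True j = ?t \<otimes> ?t" for v
    using i by (auto simp: j_def k_def pure_adj pure_Suc d_True)
  have "cj ?t (?s \<otimes> ?s) \<otimes> (?t \<otimes> ?t) = ?t \<otimes> (?s \<otimes> (?s \<otimes> ?t))"
    using c by (simp add: cj_def m_assoc)
  then have low: "com (pure True i k \<otimes> pure True j k) (pure u i j)"
    using c by (simp add: p com_iff_cj up down)
  have mid: "com (pure True j k \<otimes> pure True i j) (pure u i k)"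
    using c by (simp add: p com_iff_cj up down)
  \<comment> \<open>Goal of the computation: a_ij a_ik = s t t s. It uses the braid relation twice,
    the second time as t s t^-1 = s^-1 t s.\<close>
  have "?s \<otimes> (?s \<otimes> cj ?t (?s \<otimes> ?s)) = ?s \<otimes> (?s \<otimes> (?t \<otimes> (?s \<otimes> (?s \<otimes> inv ?t))))"
    using c by (simp add: cj_def m_assoc)
  also have "\<dots> = ?s \<otimes> ((?s \<otimes> (?t \<otimes> ?s)) \<otimes> (?s \<otimes> inv ?t))"
    using c by (simp add: m_assoc)
  also have "\<dots> = ?s \<otimes> ((?t \<otimes> (?s \<otimes> ?t)) \<otimes> (?s \<otimes> inv ?t))"
    by (simp only: br)
  also have "\<dots> = (?s \<otimes> (?t \<otimes> ?s)) \<otimes> (?t \<otimes> (?s \<otimes> inv ?t))"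
    using c by (simp add: m_assoc)
  also have "?t \<otimes> (?s \<otimes> inv ?t) = inv ?s \<otimes> (?t \<otimes> ?s)"
  proof -
    have "?s \<otimes> (?t \<otimes> (?s \<otimes> inv ?t)) = (?s \<otimes> (?t \<otimes> ?s)) \<otimes> inv ?t"
      using c by (simp add: m_assoc)
    also have "\<dots> = ?t \<otimes> ?s"
      unfolding br using c by (simp add: m_assoc)
    finally show ?thesis
      using c by (metis cancel_simps(1) inv_closed m_closed)
  qed
  also have "(?s \<otimes> (?t \<otimes> ?s)) \<otimes> (inv ?s \<otimes> (?t \<otimes> ?s)) = ?s \<otimes> (?t \<otimes> (?t \<otimes> ?s))"
    using c by (simp add: m_assoc)
  finally have "(?s \<otimes> ?s) \<otimes> cj ?t (?s \<otimes> ?s) = ?s \<otimes> (?t \<otimes> (?t \<otimes> ?s))"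
    using c by (simp add: m_assoc)
  then have "com ((?s \<otimes> ?s) \<otimes> cj ?t (?s \<otimes> ?s)) (d u j)"
    using c by (simp add: com_iff_cj up down)
  then have high: "com (pure True i j \<otimes> pure True i k) (pure u j k)"
    by (simp add: p)
  show ?thesis
    using low mid high by simp
qed

definition tri :: "bool \<Rightarrow> nat \<Rightarrow> nat \<Rightarrow> nat \<Rightarrow> bool"
  where "tri u i j k \<longleftrightarrow> com (pure True i k \<otimes> pure True j k) (pure u i j) \<and>
    com (pure True j k \<otimes> pure True i j) (pure u i k) \<and>
    com (pure True i j \<otimes> pure True i k) (pure u j k)"

lemma tri_shift:
  assumes "tri u i j k" "1 \<le> m" "m < n" "ix n i j" "ix n j k" "Suc m \<notin> {i, j, k}"
  shows "tri u (if i = m then Suc m else i) (if j = m then Suc m else j) (if k = m then Suc m else k)"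
proof -
  have "com (cj (s m) (pure True i k \<otimes> pure True j k)) (cj (s m) (pure u i j)) \<and>
    com (cj (s m) (pure True j k \<otimes> pure True i j)) (cj (s m) (pure u i k)) \<and>
    com (cj (s m) (pure True i j \<otimes> pure True i k)) (cj (s m) (pure u j k))"
    using assms(1-3) by (simp add: tri_def com_cj)
  moreover have "cj (s m) (pure u i j) =
      pure u (if i = m then Suc m else i) (if j = m then Suc m else j)"
    "cj (s m) (pure u i k) = pure u (if i = m then Suc m else i) (if k = m then Suc m else k)"
    "cj (s m) (pure u j k) = pure u (if j = m then Suc m else j) (if k = m then Suc m else k)" for u
    using assms by (intro cj_shift; force)+
  ultimately show ?thesis
    using assms(2,3) unfolding tri_def by (simp only: cj_m s_closed pure_closed)
qed

text \<open>Starting from i, i + 1, i + 2, the index k is raised first and j afterwards, so that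
  every shift goes into an unoccupied index.\<close>

lemma tri_pure:
  assumes ij: "ix n i j" and jk: "ix n j k"
  shows "tri u i j k"
proof -
  have adj: "tri u i (Suc i) k" if "Suc (Suc i) \<le> k" "k \<le> n" for k
    using that
  proof (induction k rule: dec_induct)
    case base
    then show ?case using pure_tri_base[of i u] ij by (simp add: tri_def)
  next
    case (step k)
    then have "tri u i (Suc i) k" by simp
    from tri_shift[OF this, of k] show ?case
      using ij step by simp
  qed
  have "Suc i \<le> j" using ij by simp
  then show ?thesis
    using jk
  proof (induction j rule: dec_induct)
    case base
    then show ?case by (intro adj) auto
  next
    case (step j)
    then have "tri u i j k" by simp
    from tri_shift[OF this, of j] show ?case
      using ij step by simp
  qed
qed

lemma pure_apart:
  assumes "ix n i j" "ix n k l" "j < k"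
  shows "com (pure u i j) (pure v k l)"
proof -
  have "com (s m) (pure u i j)" if "k \<le> m" "m < l" for m
    using assms that by (intro com_pure) (auto intro!: far_ss' far_sd')
  moreover have "com (d v k) (pure u i j)"
    using assms by (intro com_pure) (auto intro!: com_sym[OF far_dd] com_sym[OF far_sd])
  ultimately show ?thesis
    using assms by (intro com_pure) (auto intro: com_sym)
qed

text \<open>For k = j + 1 the commutation of disjoint pairs is conjugated by sigma_j and then by
  a_{j+1,l}, which by the triangle relation cancels the conjugation on the second generator.
  Conjugation by sigma_k then raises k.\<close>

lemma pure_crossed:
  assumes ij: "ix n i j" and jk: "ix n j k" and kl: "ix n k l"
  shows "com (cj (pure True k l) (pure u i k)) (pure v j l)"
proof -
  have "Suc j \<le> k" using jk by simp
  then show ?thesis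
    using kl
  proof (induction k rule: dec_induct)
    case base
    have j: "1 \<le> j" "j < n" "1 \<le> l" using ij base by auto
    have "com (pure u i j) (pure v (Suc j) l)"
      using ij base by (intro pure_apart) auto
    then have "com (cj (s j) (pure u i j)) (cj (s j) (pure v (Suc j) l))"
      using j by (simp add: com_cj)
    then have "com (pure u i (Suc j)) (cj (pure True j (Suc j)) (pure v j l))"
      using ij base j by (simp add: cj_s_pure twist_def)
    then have "com (cj (pure True (Suc j) l) (pure u i (Suc j)))
        (cj (pure True (Suc j) l) (cj (pure True j (Suc j)) (pure v j l)))"
      by (simp add: com_cj)
    moreover have "cj (pure True (Suc j) l) (cj (pure True j (Suc j)) (pure v j l)) = pure v j l"
      using tri_pure[of j "Suc j" l v] base j by (simp add: tri_def com_iff_cj)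
    ultimately show ?case by simp
  next
    case (step k)
    then have k: "1 \<le> k" "k < n" using ij by auto
    have "com (cj (pure True k l) (pure u i k)) (pure v j l)"
      using step by simp
    then have "com (cj (s k) (cj (pure True k l) (pure u i k))) (cj (s k) (pure v j l))"
      using k by (simp add: com_cj)
    then have "com (cj (cj (s k) (pure True k l)) (cj (s k) (pure u i k))) (cj (s k) (pure v j l))"
      using k by (simp add: cj_cj_cj)
    then show ?case
      using k ij step by (simp add: cj_shift)
  qed
qed

text \<open>For l = k + 1 this is \<open>pure_crossed\<close> conjugated by sigma_k: both generators
  acquire the same conjugator a_{k,k+1}, which is dropped. Conjugation by sigma_l then raises
  l.\<close>

lemma pure_nested:
  assumes il: "ix n i l" and jk: "ix n j k" and ij: "i < j" and kl: "k < l"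
  shows "com (pure u i l) (pure v j k)"
proof -
  have "Suc k \<le> l" using kl by simp
  then show ?thesis
    using il
  proof (induction l rule: dec_induct)
    case base
    have k: "1 \<le> k" "k < n" using base jk by auto
    have "com (cj (pure True k (Suc k)) (pure u i k)) (pure v j (Suc k))"
      using base jk ij by (intro pure_crossed) auto
    then have "com (cj (s k) (cj (pure True k (Suc k)) (pure u i k))) (cj (s k) (pure v j (Suc k)))"
      using k by (simp add: com_cj)
    then have "com (cj (cj (s k) (pure True k (Suc k))) (cj (s k) (pure u i k)))
        (cj (s k) (pure v j (Suc k)))"
      using k by (simp add: cj_cj_cj)
    then have "com (cj (pure True k (Suc k)) (pure u i (Suc k))) (cj (pure True k (Suc k)) (pure v j k))"
      using k base jk ij by (simp add: cj_s_pure twist_def)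
    then show ?case
      by (simp add: com_cj)
  next
    case (step l)
    have l: "1 \<le> l" "l < n" using step by auto
    have "com (pure u i l) (pure v j k)"
      using step jk ij by simp
    then have "com (cj (s l) (pure u i l)) (cj (s l) (pure v j k))"
      using l by (simp add: com_cj)
    then show ?case
      using l step jk ij by (simp add: cj_shift)
  qed
qed

lemma sp_family_pure: "sp_family G n pure"
  using tri_pure
  by unfold_locales (auto simp: tri_def intro: pure_same pure_apart pure_nested pure_crossed)

end

section \<open>The pure generators in the singular braid group\<close>

lemma (in group) cj_cj_eqI:
  assumes "a \<otimes> (b \<otimes> e) = e' \<otimes> (a \<otimes> b)"
    and "a \<in> carrier G" "b \<in> carrier G" "e \<in> carrier G" "e' \<in> carrier G"
  shows "cj a (cj b e) = e'"
proof -
  have "cj a (cj b e) = (a \<otimes> (b \<otimes> e)) \<otimes> (inv b \<otimes> inv a)"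
    using assms(2-) by (simp add: cj_def word_simps)
  then show ?thesis
    unfolding assms(1) using assms(2-) by (simp add: word_simps)
qed

abbreviation sp_gen_of :: "bool \<Rightarrow> nat \<Rightarrow> nat \<Rightarrow> sp_gen"
  where "sp_gen_of u p q \<equiv> if u then SpA p q else SpB p q"

abbreviation sg_s :: "nat \<Rightarrow> nat \<Rightarrow> sg_gen gword set"
  where "sg_s n i \<equiv> sg_elem n (\<sigma> i)"

abbreviation sg_d :: "nat \<Rightarrow> bool \<Rightarrow> nat \<Rightarrow> sg_gen gword set"
  where "sg_d n u i \<equiv> sg_elem n ((if u then \<sigma> i else \<tau> i) @ \<sigma> i)"

lemma in_sg_gens [simp]:
  "SgSigma i \<in> sg_gens n \<longleftrightarrow> i \<in> {1..<n}" "SgTau i \<in> sg_gens n \<longleftrightarrow> i \<in> {1..<n}"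
  by (auto simp: sg_gens_def)

lemma sg_elem_closed: "w \<in> words (sg_gens n) \<Longrightarrow> sg_elem n w \<in> carrier (SG n)"
  by (simp add: sg_elem_def SG_def presented_group_carrier)

lemma sg_elem_mult:
  "\<lbrakk>u \<in> words (sg_gens n); v \<in> words (sg_gens n)\<rbrakk> \<Longrightarrow>
    sg_elem n (u @ v) = sg_elem n u \<otimes>\<^bsub>SG n\<^esub> sg_elem n v"
  by (simp add: sg_elem_def SG_def presented_group_mult)

lemma sg_elem_rel:
  "\<lbrakk>(u, v) \<in> sg_rels n; u \<in> words (sg_gens n); v \<in> words (sg_gens n)\<rbrakk> \<Longrightarrow> sg_elem n u = sg_elem n v"
  by (simp add: sg_elem_def wclass_eq_iff pres_eq.rel)

lemma braid_family_SG: "braid_family (SG n) n (sg_s n) (sg_d n)"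
proof -
  interpret group "SG n" by (rule group_SG)
  let ?S = "sg_s n" and ?T = "\<lambda>i. sg_elem n (\<tau> i)"
  have S [simp]: "?S i \<in> carrier (SG n)" and T [simp]: "?T i \<in> carrier (SG n)"
    if "1 \<le> i" "i < n" for i
    using that by (auto intro: sg_elem_closed)
  have d: "sg_d n u i = (if u then ?S i else ?T i) \<otimes>\<^bsub>SG n\<^esub> ?S i" if "1 \<le> i" "i < n" for u i
    using that by (auto simp del: append.simps intro!: sg_elem_mult)
  have rel2: "sg_elem n u \<otimes>\<^bsub>SG n\<^esub> sg_elem n v = sg_elem n v \<otimes>\<^bsub>SG n\<^esub> sg_elem n u"
    if "(u @ v, v @ u) \<in> sg_rels n" "u \<in> words (sg_gens n)" "v \<in> words (sg_gens n)" for u v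
    using sg_elem_rel[OF that(1)] that(2,3) by (simp add: sg_elem_mult)
  have rel3: "sg_elem n u \<otimes>\<^bsub>SG n\<^esub> (sg_elem n v \<otimes>\<^bsub>SG n\<^esub> sg_elem n w) =
      sg_elem n u' \<otimes>\<^bsub>SG n\<^esub> (sg_elem n v' \<otimes>\<^bsub>SG n\<^esub> sg_elem n w')"
    if "(u @ v @ w, u' @ v' @ w') \<in> sg_rels n" "u @ v @ w \<in> words (sg_gens n)"
      "u' @ v' @ w' \<in> words (sg_gens n)" for u v w u' v' w'
    using sg_elem_rel[OF that] that(2,3) by (simp add: sg_elem_mult)
  have ss: "com (?S i) (?S j)" and tt: "com (?T i) (?T j)" and ts: "com (?T i) (?S j)"
    if "1 \<le> i" "1 \<le> j" "i < n" "j < n" "i + 2 \<le> j \<or> j + 2 \<le> i" for i j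
    using that rel2[OF sg_rels.sigma_sigma[of i n j]] rel2[OF sg_rels.tau_tau[of i n j]]
      rel2[OF sg_rels.tau_sigma[of i n j]]
    by (simp_all add: com_def)
  have same: "com (?T i) (?S i)" if "1 \<le> i" "i < n" for i
    using that rel2[OF sg_rels.tau_sigma_same[of i n]] by (simp add: com_def)
  have br: "?S i \<otimes>\<^bsub>SG n\<^esub> (?S (Suc i) \<otimes>\<^bsub>SG n\<^esub> ?S i) =
      ?S (Suc i) \<otimes>\<^bsub>SG n\<^esub> (?S i \<otimes>\<^bsub>SG n\<^esub> ?S (Suc i))" if "1 \<le> i" "Suc i < n" for i
    using that rel3[OF sg_rels.braid[of i n]] by simp
  have up: "cj (?S i) (cj (?S (Suc i)) (?T i)) = ?T (Suc i)"
    and down: "cj (?S (Suc i)) (cj (?S i) (?T (Suc i))) = ?T i"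
    and upS: "cj (?S i) (cj (?S (Suc i)) (?S i)) = ?S (Suc i)"
    and downS: "cj (?S (Suc i)) (cj (?S i) (?S (Suc i))) = ?S i" if "1 \<le> i" "Suc i < n" for i
  proof -
    have "?S i \<otimes>\<^bsub>SG n\<^esub> (?S (Suc i) \<otimes>\<^bsub>SG n\<^esub> ?T i) =
        ?T (Suc i) \<otimes>\<^bsub>SG n\<^esub> (?S i \<otimes>\<^bsub>SG n\<^esub> ?S (Suc i))"
      using that rel3[OF sg_rels.slide_up[of i n]] by simp
    then show "cj (?S i) (cj (?S (Suc i)) (?T i)) = ?T (Suc i)"
      using that by (intro cj_cj_eqI) auto
    have "?S (Suc i) \<otimes>\<^bsub>SG n\<^esub> (?S i \<otimes>\<^bsub>SG n\<^esub> ?T (Suc i)) =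
        ?T i \<otimes>\<^bsub>SG n\<^esub> (?S (Suc i) \<otimes>\<^bsub>SG n\<^esub> ?S i)"
      using that rel3[OF sg_rels.slide_down[of i n]] by simp
    then show "cj (?S (Suc i)) (cj (?S i) (?T (Suc i))) = ?T i"
      using that by (intro cj_cj_eqI) auto
    show "cj (?S i) (cj (?S (Suc i)) (?S i)) = ?S (Suc i)"
      using that by (intro cj_cj_eqI br) auto
    show "cj (?S (Suc i)) (cj (?S i) (?S (Suc i))) = ?S i"
      using that by (intro cj_cj_eqI br[symmetric]) auto
  qed
  note ss' = ss com_sym[OF ss] and ts' = ts com_sym[OF ts]
  show ?thesis
  proof
    fix i j :: nat and u v
    show "?S i \<in> carrier (SG n)" if "1 \<le> i" "i < n" using that by simp
    show "sg_d n u i \<in> carrier (SG n)" if "1 \<le> i" "i < n" using that by (simp add: d del: append.simps)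
    show "sg_d n True i = ?S i \<otimes>\<^bsub>SG n\<^esub> ?S i" if "1 \<le> i" "i < n"
      using d[OF that, of True] by simp
    show "com (?S i) (sg_d n u i)" if "1 \<le> i" "i < n"
      unfolding d[OF that] using that same by (auto intro!: com_mult_right intro: com_refl com_sym)
    show "com (?S i) (?S j)" if "1 \<le> i" "i + 2 \<le> j" "j < n"
      using that by (intro ss) auto
    show "com (?S i) (sg_d n u j)" if ij: "1 \<le> i" "i + 2 \<le> j" "j < n"
    proof -
      have "1 \<le> j" "i < n" using ij by auto
      with ij show ?thesis
        using ss[of i j] ts[of j i] by (auto simp: d intro!: com_mult_right intro: com_sym)
    qed
    show "com (sg_d n u i) (?S j)" if ij: "1 \<le> i" "i + 2 \<le> j" "j < n"
    proof -
      have "1 \<le> j" "i < n" using ij by auto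
      with ij show ?thesis
        using ss[of i j] ts[of i j] by (auto simp: d intro!: com_mult)
    qed
    show "com (sg_d n u i) (sg_d n v j)" if ij: "1 \<le> i" "i + 2 \<le> j" "j < n"
    proof -
      have "1 \<le> j" "i < n" using ij by auto
      with ij show ?thesis
        using ss[of i j] tt[of i j] ts[of i j] com_sym[OF ts[of j i]]
        by (auto simp: d intro!: com_mult com_mult_right)
    qed
    show "?S i \<otimes>\<^bsub>SG n\<^esub> (?S (Suc i) \<otimes>\<^bsub>SG n\<^esub> ?S i) =
        ?S (Suc i) \<otimes>\<^bsub>SG n\<^esub> (?S i \<otimes>\<^bsub>SG n\<^esub> ?S (Suc i))" if "1 \<le> i" "Suc i < n"
      by (rule br[OF that])
    show "cj (?S i) (cj (?S (Suc i)) (sg_d n u i)) = sg_d n u (Suc i)" if "1 \<le> i" "Suc i < n"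
      using that by (simp add: d cj_m up[OF that] upS[OF that] del: append.simps)
    show "cj (?S (Suc i)) (cj (?S i) (sg_d n u (Suc i))) = sg_d n u i" if "1 \<le> i" "Suc i < n"
      using that by (simp add: d cj_m down[OF that] downS[OF that] del: append.simps)
  qed
qed

lemma sg_inv: "1 \<le> i \<Longrightarrow> i < n \<Longrightarrow> inv\<^bsub>SG n\<^esub> sg_s n i = sg_elem n [(SgSigma i, False)]"
  by (simp add: SG_def sg_elem_def wgen_inv)

lemma sp_elem_eq_pure:
  assumes "ix n p q"
  shows "sp_elem n (sp_gen_of u p q) = braid_family.pure (SG n) n (sg_s n) (sg_d n) u p q"
proof -
  interpret braid_family "SG n" n "sg_s n" "sg_d n" by (rule braid_family_SG)
  define w where "w = (if u then \<sigma> p else \<tau> p) @ \<sigma> p"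
  have w: "w \<in> words (sg_gens n)" using assms by (auto simp: w_def)
  have "Suc p \<le> q" using assms by simp
  then have "sg_elem n (conj_word p q w) = pure u p q \<and> conj_word p q w \<in> words (sg_gens n)"
    using assms
  proof (induction q rule: dec_induct)
    case base
    then show ?case using w by (simp add: conj_word_def pure_adj w_def)
  next
    case (step q)
    have q: "1 \<le> q" "q < n" using step by auto
    have IH: "sg_elem n (conj_word p q w) = pure u p q" "conj_word p q w \<in> words (sg_gens n)"
      using step by auto
    have eq: "conj_word p (Suc q) w = \<sigma> q @ (conj_word p q w @ [(SgSigma q, False)])"
      using step by (simp add: conj_word_def)
    have wd: "\<sigma> q \<in> words (sg_gens n)" "[(SgSigma q, False)] \<in> words (sg_gens n)"
      using q by auto
    have "sg_elem n (conj_word p (Suc q) w) = cj (sg_s n q) (pure u p q)"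
      unfolding eq using q IH wd
      by (simp add: sg_elem_mult sg_inv[symmetric] cj_def m_assoc del: append.simps)
    then show ?case
      using step q IH(2) wd by (simp add: pure_Suc eq del: append.simps) 
  qed
  moreover have "sp_word (sp_gen_of u p q) = conj_word p q w"
    by (simp add: w_def)
  ultimately show ?thesis
    by (simp add: sp_elem_def)
qed

lemma sp_gens_cases:
  assumes "z \<in> sp_gens n"
  obtains u p q where "ix n p q" "z = sp_gen_of u p q"
proof -
  from assms consider p q where "ix n p q" "z = SpA p q" | p q where "ix n p q" "z = SpB p q"
    unfolding sp_gens_def by blast
  then show ?thesis
  proof cases
    case 1
    then show ?thesis using that[of _ _ True] by simp
  next
    case 2
    then show ?thesis using that[of _ _ False] by simp
  qed
qed

lemma in_sp_gens [simp]:
  "SpA p q \<in> sp_gens n \<longleftrightarrow> ix n p q" "SpB p q \<in> sp_gens n \<longleftrightarrow> ix n p q"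
  by (auto simp: sp_gens_def)

lemma sp_rels_words:
  assumes "(u, v) \<in> sp_rels n"
  shows "u \<in> words (sp_gens n)" "v \<in> words (sp_gens n)"
  using assms by (cases; auto simp: wpow_def winv_def wcomm_def)+

section \<open>The presented group embeds\<close>

abbreviation sp_pres :: "nat \<Rightarrow> sp_gen gword set monoid"
  where "sp_pres n \<equiv> presented_group (sp_gens n) (sp_rels n)"

definition pgen :: "nat \<Rightarrow> bool \<Rightarrow> nat \<Rightarrow> nat \<Rightarrow> sp_gen gword set"
  where "pgen n u p q = (if ix n p q then wgen (sp_gens n) (sp_rels n) (sp_gen_of u p q)
    else \<one>\<^bsub>sp_pres n\<^esub>)"

lemma sp_val_sp_gen_of [simp]: "sp_val x (sp_gen_of u p q) = x u p q"
  by simp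

lemma sp_family_pgen: "sp_family (sp_pres n) n (pgen n)"
proof (rule group.sp_family_if_rels[OF group_presented_group])
  interpret group "sp_pres n" by (rule group_presented_group)
  show "pgen n u i j \<in> carrier (sp_pres n)" for u i j
    using wgen_closed[of "sp_gens n" "sp_rels n"] one_closed by (auto simp: pgen_def Pi_iff)
  have "weval (sp_pres n) (sp_val (pgen n)) w = wclass (sp_gens n) (sp_rels n) w"
    if "w \<in> words (sp_gens n)" for w
  proof -
    have "sp_val (pgen n) z = wgen (sp_gens n) (sp_rels n) z" if "z \<in> sp_gens n" for z
      using that by (cases z) (simp_all add: pgen_def)
    then have "weval (sp_pres n) (sp_val (pgen n)) w = weval (sp_pres n) (wgen (sp_gens n) (sp_rels n)) w"
      using that by (rule weval_cong)
    then show ?thesis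
      by (simp add: weval_wgen[OF that])
  qed
  then show "weval (sp_pres n) (sp_val (pgen n)) p = weval (sp_pres n) (sp_val (pgen n)) q"
    if "(p, q) \<in> sp_rels n" for p q
    using sp_rels_words[OF that] that by (simp add: wclass_eq_iff pres_eq.rel)
qed

context sp_family begin

lemma sp_val_closed_gens: "sp_val x \<in> X \<rightarrow> carrier G"
  using sp_val_closed by auto

lemma lift_hom: "pres_lift G (sp_val x) \<in> hom (sp_pres n) G"
  by (rule pres_lift(2)[OF sp_val_closed_gens weval_rels])

lemma lift_pgen: "ix n p q \<Longrightarrow> pres_lift G (sp_val x) (pgen n u p q) = x u p q"
  using pres_lift(3)[OF sp_val_closed_gens weval_rels, where x = "sp_gen_of u p q" and X = "sp_gens n"]
  by (cases u) (simp_all add: pgen_def)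

end

text \<open>For 1 \<le> s < n the twisted family again satisfies the commutation list, hence the
  relations, so this lift is a homomorphism.\<close>

definition theta :: "nat \<Rightarrow> nat \<Rightarrow> sp_gen gword set \<Rightarrow> sp_gen gword set"
  where "theta n s = pres_lift (sp_pres n) (sp_val (group.twist (sp_pres n) s (pgen n)))"

lemma twisted_family_pgen: "twisted_family (sp_pres n) n (pgen n) (theta n)"
proof -
  interpret sp_family "sp_pres n" n "pgen n" by (rule sp_family_pgen)
  show ?thesis
  proof
    fix s assume s: "1 \<le> s" "s < n"
    interpret T: sp_family "sp_pres n" n "twist s (pgen n)"
      using s by (intro twist) auto
    show "theta n s \<in> hom (sp_pres n) (sp_pres n)"
      unfolding theta_def by (rule T.lift_hom)
    show "theta n s (pgen n u p q) = twist s (pgen n) u p q" if "ix n p q" for u p q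
      unfolding theta_def using that by (rule T.lift_pgen)
  next
    fix h k g
    assume hk: "h \<in> hom (sp_pres n) (sp_pres n)" "k \<in> hom (sp_pres n) (sp_pres n)"
      and eq: "\<And>u i j. ix n i j \<Longrightarrow> h (pgen n u i j) = k (pgen n u i j)"
      and g: "g \<in> carrier (sp_pres n)"
    have "h (wgen (sp_gens n) (sp_rels n) z) = k (wgen (sp_gens n) (sp_rels n) z)"
      if "z \<in> sp_gens n" for z
    proof -
      obtain u p q where "ix n p q" "z = sp_gen_of u p q"
        using \<open>z \<in> sp_gens n\<close> by (rule sp_gens_cases)
      then show ?thesis using eq[of p q u] by (simp add: pgen_def split del: if_split)
    qed
    from presented_group_hom_eq[OF group_presented_group hk this g] show "h g = k g" .
  qed
qed

lemma sp_family_SG: "sp_family (SG n) n (braid_family.pure (SG n) n (sg_s n) (sg_d n))"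
  using braid_family.sp_family_pure[OF braid_family_SG] .

text \<open>Composing h with the action of SG_n on the states gives left multiplication, which is
  faithful because g is recovered from its effect on the state (1, id).\<close>

lemma lift_SG_inj:
  assumes h: "h \<in> hom (sp_pres n) (SG n)"
    and gens: "\<And>u p q. ix n p q \<Longrightarrow> h (pgen n u p q) = sp_elem n (sp_gen_of u p q)"
  shows "inj_on h (carrier (sp_pres n))"
proof -
  interpret twisted_family "sp_pres n" n "pgen n" "theta n" by (rule twisted_family_pgen)
  interpret S: braid_family "SG n" n "sg_s n" "sg_d n" by (rule braid_family_SG)
  define d where "d u i = lmul (pgen n u i (Suc i))" for u i
  interpret B: braid_family "BijGroup states" n act d
    unfolding d_def by (rule braid_family_act)
  let ?f = "sg_val act (\<lambda>i. d False i \<otimes>\<^bsub>BijGroup states\<^esub> inv\<^bsub>BijGroup states\<^esub> act i)"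
  have f: "?f \<in> sg_gens n \<rightarrow> carrier (BijGroup states)"
    by (auto simp: sg_gens_def)
  define \<Psi> where "\<Psi> = pres_lift (BijGroup states) ?f"
  have \<Psi>_hom: "\<Psi> \<in> hom (SG n) (BijGroup states)"
    unfolding \<Psi>_def SG_def by (rule B.pres_lift(2)[OF f B.weval_sg_rels])
  interpret \<Psi>: group_hom "SG n" "BijGroup states" \<Psi>
    using \<Psi>_hom by (simp add: group_hom_def group_hom_axioms_def S.group_axioms B.group_axioms)
  have \<Psi>_word: "\<Psi> (sg_elem n w) = weval (BijGroup states) ?f w" if "w \<in> words (sg_gens n)" for w
    unfolding \<Psi>_def sg_elem_def by (rule B.pres_lift(1)[OF f B.weval_sg_rels that])
  have \<Psi>_s: "\<Psi> (sg_s n i) = act i" and \<Psi>_d: "\<Psi> (sg_d n u i) = d u i" if "1 \<le> i" "i < n" for u i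
    using that B.d_True[OF that] by (simp_all add: \<Psi>_word weval_Cons B.m_assoc)
  \<comment> \<open>Raising q is conjugation by sigma_q in SG_n; under the action it becomes
    \<open>theta n q\<close> on the multiplier, which raises the same index in P.\<close>
  have \<Psi>_pure: "\<Psi> (S.pure u p q) = lmul (pgen n u p q)" if "ix n p q" for u p q
  proof -
    have "Suc p \<le> q" using that by simp
    then show ?thesis
      using that
    proof (induction q rule: dec_induct)
      case base
      then show ?case using \<Psi>_d[of p u] by (simp add: S.pure_adj d_def)
    next
      case (step q)
      then have q: "1 \<le> q" "q < n" "ix n p q" by auto
      have "\<Psi> (S.pure u p (Suc q)) = B.cj (act q) (lmul (pgen n u p q))"
        using step q \<Psi>_s[of q] by (simp add: S.pure_Suc S.cj_def B.cj_def)
      also have "\<dots> = lmul (pgen n u p (Suc q))"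
        using q by (simp add: Bij_cj_act_lmul theta_simps)
      finally show ?case .
    qed
  qed
  have eq: "\<Psi> (h g) = lmul g" if g: "g \<in> carrier (sp_pres n)" for g
  proof -
    have "(\<lambda>g. \<Psi> (h g)) \<in> hom (sp_pres n) (BijGroup states)"
      using h \<Psi>_hom by (auto simp: hom_def Pi_iff)
    moreover have "\<Psi> (h (wgen (sp_gens n) (sp_rels n) z)) = lmul (wgen (sp_gens n) (sp_rels n) z)"
      if z: "z \<in> sp_gens n" for z
    proof -
      obtain u p q where pq: "ix n p q" "z = sp_gen_of u p q"
        using z by (rule sp_gens_cases)
      then have "wgen (sp_gens n) (sp_rels n) z = pgen n u p q"
        by (simp add: pgen_def)
      then show ?thesis
        using \<Psi>_pure[OF pq(1), of u] gens[OF pq(1), of u] sp_elem_eq_pure[OF pq(1), of u] by metis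
    qed
    ultimately show ?thesis
      using presented_group_hom_eq[OF B.group_axioms _ lmul_hom _ g] by blast
  qed
  show ?thesis
  proof (rule inj_onI)
    fix g k assume gk: "g \<in> carrier (sp_pres n)" "k \<in> carrier (sp_pres n)" "h g = h k"
    then have "lmul g (\<one>\<^bsub>sp_pres n\<^esub>, id) = lmul k (\<one>\<^bsub>sp_pres n\<^esub>, id)"
      using eq by metis
    then show "g = k"
      using gk by (simp add: lmul_app)
  qed
qed

section \<open>The pure generators generate the kernel\<close>

abbreviation sp_sub :: "nat \<Rightarrow> sg_gen gword set set"
  where "sp_sub n \<equiv> generate (SG n) (sp_elem n ` sp_gens n)"

abbreviation sp_ker :: "nat \<Rightarrow> sg_gen gword set set"
  where "sp_ker n \<equiv> kernel (SG n) (sym_group n) (sg_perm n)"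

lemma group_hom_sg_perm: "group_hom (SG n) (sym_group n) (sg_perm n)"
  by (simp add: group_hom_def group_hom_axioms_def group_SG sym_group_is_group sg_perm_hom)

lemma sg_d_ker: "1 \<le> i \<Longrightarrow> i < n \<Longrightarrow> sg_d n u i \<in> sp_ker n"
proof -
  assume i: "1 \<le> i" "i < n"
  interpret group_hom "SG n" "sym_group n" "sg_perm n" by (rule group_hom_sg_perm)
  have "sg_d n u i = sg_elem n (if u then \<sigma> i else \<tau> i) \<otimes>\<^bsub>SG n\<^esub> sg_s n i"
    using i by (intro sg_elem_mult) auto
  moreover have "sg_elem n (if u then \<sigma> i else \<tau> i) \<in> carrier (SG n)" "sg_s n i \<in> carrier (SG n)"
    using i by (auto intro: sg_elem_closed)
  ultimately show ?thesis
    using i by (auto simp: kernel_def sg_perm_gens sym_group_mult sym_group_one)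
qed

lemma sp_elem_ker:
  assumes "z \<in> sp_gens n"
  shows "sp_elem n z \<in> sp_ker n"
proof -
  interpret S: braid_family "SG n" n "sg_s n" "sg_d n" by (rule braid_family_SG)
  interpret P: group_hom "SG n" "sym_group n" "sg_perm n" by (rule group_hom_sg_perm)
  interpret K: normal "sp_ker n" "SG n" by (rule P.normal_kernel)
  obtain u p q where pq: "ix n p q" "z = sp_gen_of u p q"
    using assms by (rule sp_gens_cases)
  have "Suc p \<le> q" using pq(1) by simp
  then have "S.pure u p q \<in> sp_ker n"
    using pq(1)
  proof (induction q rule: dec_induct)
    case base
    then show ?case using sg_d_ker[of p n u] by (simp add: S.pure_adj)
  next
    case (step q)
    then show ?case
      by (simp add: S.pure_Suc S.cj_def K.inv_op_closed2)
  qed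
  then show ?thesis
    using sp_elem_eq_pure[OF pq(1), of u] pq(2) by simp
qed

lemma sp_sub_subset_ker: "sp_sub n \<subseteq> sp_ker n"
  by (rule group.generate_subgroup_incl[OF group_SG image_subsetI[OF sp_elem_ker]
        group_hom.subgroup_kernel[OF group_hom_sg_perm]])

lemma sp_elem_carrier: "sp_elem n ` sp_gens n \<subseteq> carrier (SG n)"
  using sp_elem_ker by (auto simp: kernel_def)

lemma SG_induct [consumes 1, case_names one sigma sigma_inv tau tau_inv]:
  assumes g: "g \<in> carrier (SG n)"
    and one: "Q \<one>\<^bsub>SG n\<^esub>"
    and sigma: "\<And>i g. \<lbrakk>1 \<le> i; i < n; g \<in> carrier (SG n); Q g\<rbrakk> \<Longrightarrow> Q (sg_s n i \<otimes>\<^bsub>SG n\<^esub> g)"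
    and sigma_inv: "\<And>i g. \<lbrakk>1 \<le> i; i < n; g \<in> carrier (SG n); Q g\<rbrakk> \<Longrightarrow>
      Q (inv\<^bsub>SG n\<^esub> sg_s n i \<otimes>\<^bsub>SG n\<^esub> g)"
    and tau: "\<And>i g. \<lbrakk>1 \<le> i; i < n; g \<in> carrier (SG n); Q g\<rbrakk> \<Longrightarrow>
      Q (sg_elem n (\<tau> i) \<otimes>\<^bsub>SG n\<^esub> g)"
    and tau_inv: "\<And>i g. \<lbrakk>1 \<le> i; i < n; g \<in> carrier (SG n); Q g\<rbrakk> \<Longrightarrow>
      Q (inv\<^bsub>SG n\<^esub> sg_elem n (\<tau> i) \<otimes>\<^bsub>SG n\<^esub> g)"
  shows "Q g"
proof -
  interpret group "SG n" by (rule group_SG)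
  let ?f = "wgen (sg_gens n) (sg_rels n)"
  have f: "?f \<in> sg_gens n \<rightarrow> carrier (SG n)"
    unfolding SG_def by (rule wgen_closed)
  obtain w where w: "w \<in> words (sg_gens n)" "g = weval (SG n) ?f w"
    using g by (auto simp: SG_def presented_group_carrier weval_wgen)
  have "Q (weval (SG n) ?f w)"
    using w(1)
  proof (induction w)
    case (Cons p w)
    obtain z b where p: "p = (z, b)" by fastforce
    have IH: "Q (weval (SG n) ?f w)" "weval (SG n) ?f w \<in> carrier (SG n)"
      using Cons weval_closed[OF f] by auto
    show ?case
    proof (cases z)
      case (SgSigma i)
      then show ?thesis
        using Cons.prems IH sigma[of i] sigma_inv[of i] by (simp add: weval_Cons p sg_elem_def)
    next
      case (SgTau i)
      then show ?thesis
        using Cons.prems IH tau[of i] tau_inv[of i] by (simp add: weval_Cons p sg_elem_def)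
    qed
  qed (use one in simp)
  then show ?thesis using w by simp
qed

lemma sg_tau_closed: "1 \<le> i \<Longrightarrow> i < n \<Longrightarrow> sg_elem n (\<tau> i) \<in> carrier (SG n)"
  by (auto intro: sg_elem_closed)

lemma sg_tau_eq:
  assumes "1 \<le> i" "i < n"
  shows "sg_elem n (\<tau> i) = sg_d n False i \<otimes>\<^bsub>SG n\<^esub> inv\<^bsub>SG n\<^esub> sg_s n i"
proof -
  interpret S: braid_family "SG n" n "sg_s n" "sg_d n" by (rule braid_family_SG)
  have "sg_d n False i = sg_elem n (\<tau> i) \<otimes>\<^bsub>SG n\<^esub> sg_s n i"
    using assms sg_elem_mult[of "\<tau> i" n "\<sigma> i"] by simp
  then show ?thesis
    using assms sg_tau_closed[OF assms] by (simp add: S.m_assoc)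
qed

lemma sg_d_sp_sub:
  assumes "1 \<le> i" "i < n"
  shows "sg_d n u i \<in> sp_sub n"
proof -
  interpret S: braid_family "SG n" n "sg_s n" "sg_d n" by (rule braid_family_SG)
  have "sp_gen_of u i (Suc i) \<in> sp_gens n" "sp_elem n (sp_gen_of u i (Suc i)) = sg_d n u i"
    using assms sp_elem_eq_pure[of i "Suc i" n u] by (cases u; simp add: S.pure_adj)+
  then show ?thesis
    by (metis generate.incl imageI)
qed

text \<open>Conjugation by sigma_i permutes the generators up to conjugation inside the subgroup.
  The other letters differ from sigma_i by members of the subgroup: sigma_i^-1 = a_{i,i+1}^-1
  sigma_i and tau_i = b_{i,i+1} sigma_i^-1.\<close>

lemma sp_sub_normal: "normal (sp_sub n) (SG n)"
proof -
  interpret S: braid_family "SG n" n "sg_s n" "sg_d n" by (rule braid_family_SG)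
  interpret F: sp_family "SG n" n S.pure by (rule S.sp_family_pure)
  interpret N: subgroup "sp_sub n" "SG n"
    by (rule S.generate_is_subgroup[OF sp_elem_carrier])
  have pure: "S.pure u p q \<in> sp_sub n" if "ix n p q" for u p q
  proof -
    have "sp_gen_of u p q \<in> sp_gens n" using that by simp
    then show ?thesis
      unfolding sp_elem_eq_pure[OF that, symmetric] by (blast intro: generate.incl)
  qed
  have cjN: "S.cj g h \<in> sp_sub n" if "g \<in> sp_sub n" "h \<in> sp_sub n" for g h
    using that by (simp add: S.cj_def)
  have tw: "S.twist i S.pure u p q \<in> sp_sub n" if i: "1 \<le> i" "i < n" and pq: "ix n p q" for i u p q
  proof (cases "p = i \<and> q = Suc i")
    case True
    then show ?thesis using pure[OF pq] by (simp add: S.twist_def)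
  next
    case False
    have ii: "S.pure True i (Suc i) \<in> sp_sub n" using i by (intro pure) auto
    have "ix n (transpose i (Suc i) p) (transpose i (Suc i) q)"
      using False i pq by (auto simp: transpose_def)
    from pure[OF this, of u] cjN[OF ii pure[OF this, of u]] False show ?thesis
      by (auto simp: S.twist_def)
  qed
  have gens: "\<exists>u p q. ix n p q \<and> h = S.pure u p q" if h: "h \<in> sp_elem n ` sp_gens n" for h
  proof -
    obtain z where z: "z \<in> sp_gens n" "h = sp_elem n z" using h by blast
    from z(1) obtain u p q where pq: "ix n p q" "z = sp_gen_of u p q" by (rule sp_gens_cases)
    then show ?thesis using z(2) sp_elem_eq_pure[OF pq(1), of u] by blast
  qed
  have cj_s: "S.cj (sg_s n i) h \<in> sp_sub n" if i: "1 \<le> i" "i < n" and "h \<in> sp_sub n" for i h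
    using that(3)
  proof (induction rule: generate.induct)
    case one
    then show ?case using i by simp
  next
    case (incl h)
    then obtain u p q where pq: "ix n p q" "h = S.pure u p q"
      using gens by blast
    show ?case
      unfolding pq(2) S.cj_s_pure[OF i pq(1)] by (rule tw[OF i pq(1)])
  next
    case (inv h)
    then obtain u p q where pq: "ix n p q" "h = S.pure u p q"
      using gens by blast
    have "S.cj (sg_s n i) h \<in> sp_sub n"
      unfolding pq(2) S.cj_s_pure[OF i pq(1)] by (rule tw[OF i pq(1)])
    moreover have "S.cj (sg_s n i) (inv\<^bsub>SG n\<^esub> h) = inv\<^bsub>SG n\<^esub> S.cj (sg_s n i) h"
      using i pq by (simp add: S.cj_def S.word_simps)
    ultimately show ?case by simp
  next
    case (eng h k)
    then show ?case
      using i by (simp add: S.cj_m)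
  qed
  note d = sg_d_sp_sub
  have cj_si: "S.cj (inv\<^bsub>SG n\<^esub> sg_s n i) h \<in> sp_sub n"
    if i: "1 \<le> i" "i < n" and h: "h \<in> sp_sub n" for i h
  proof -
    have eq: "S.cj (inv\<^bsub>SG n\<^esub> sg_s n i) h = S.cj (inv\<^bsub>SG n\<^esub> sg_d n True i) (S.cj (sg_s n i) h)"
      unfolding S.d_True[OF i] using i h by (simp add: S.cj_def S.word_simps)
    show ?thesis
      unfolding eq by (rule cjN[OF N.m_inv_closed[OF d[OF i]] cj_s[OF i h]])
  qed
  have cj_t: "S.cj (sg_elem n (\<tau> i)) h \<in> sp_sub n"
    and cj_ti: "S.cj (inv\<^bsub>SG n\<^esub> sg_elem n (\<tau> i)) h \<in> sp_sub n"
    if i: "1 \<le> i" "i < n" and h: "h \<in> sp_sub n" for i h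
  proof -
    define e where "e = sg_d n False i"
    have e: "e \<in> sp_sub n" "e \<in> carrier (SG n)" and s: "sg_s n i \<in> carrier (SG n)"
      unfolding e_def by (rule d[OF i], rule S.d_closed[OF i], rule S.s_closed[OF i])
    note tau = sg_tau_eq[OF i, folded e_def]
    show "S.cj (sg_elem n (\<tau> i)) h \<in> sp_sub n"
      unfolding tau using e s h cjN cj_si[OF i h] by simp
    show "S.cj (inv\<^bsub>SG n\<^esub> sg_elem n (\<tau> i)) h \<in> sp_sub n"
      unfolding tau using e s h cj_s[OF i cjN[OF N.m_inv_closed[OF e(1)] h]]
      by (simp add: S.inv_mult_group)
  qed
  have "S.cj g h \<in> sp_sub n" if "g \<in> carrier (SG n)" "h \<in> sp_sub n" for g h
    using that
  proof (induction arbitrary: h rule: SG_induct)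
    case one
    then show ?case by simp
  next
    case (sigma i g)
    then show ?case by (simp add: cj_s)
  next
    case (sigma_inv i g)
    then show ?case by (simp add: cj_si)
  next
    case (tau i g)
    then show ?case
      by (simp add: cj_t sg_tau_closed)
  next
    case (tau_inv i g)
    then show ?case
      by (simp add: cj_ti sg_tau_closed)
  qed
  then show ?thesis
    unfolding S.normal_inv_iff S.cj_def using N.subgroup_axioms by blast
qed

text \<open>Such an r sends sigma_i and tau_i to one common involution, and these involutions
  satisfy the Coxeter relations. A word for the identity permutation is trivial modulo them.\<close>

lemma hom_trivial_on_ker:
  assumes Q: "group Q" and r: "r \<in> hom (SG n) Q"
    and triv: "\<And>i u. \<lbrakk>1 \<le> i; i < n\<rbrakk> \<Longrightarrow> r (sg_d n u i) = \<one>\<^bsub>Q\<^esub>"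
    and g: "g \<in> sp_ker n"
  shows "r g = \<one>\<^bsub>Q\<^esub>"
proof -
  interpret S: braid_family "SG n" n "sg_s n" "sg_d n" by (rule braid_family_SG)
  interpret P: group_hom "SG n" "sym_group n" "sg_perm n" by (rule group_hom_sg_perm)
  interpret Q: group Q by (rule Q)
  interpret r: group_hom "SG n" Q r
    using r by (simp add: group_hom_def group_hom_axioms_def S.group_axioms Q)
  define f where "f i = r (sg_s n i)" for i
  have f: "f \<in> {1..<n} \<rightarrow> carrier Q"
    by (auto simp: f_def)
  have sq: "f i \<otimes>\<^bsub>Q\<^esub> f i = \<one>\<^bsub>Q\<^esub>" if "i \<in> {1..<n}" for i
  proof -
    have i: "1 \<le> i" "i < n" using that by auto
    have "f i \<otimes>\<^bsub>Q\<^esub> f i = r (sg_s n i \<otimes>\<^bsub>SG n\<^esub> sg_s n i)"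
      unfolding f_def using S.s_closed[OF i] by (rule r.hom_mult[symmetric, rotated]) (rule S.s_closed[OF i])
    then show ?thesis
      unfolding S.d_True[OF i, symmetric] triv[OF i] .
  qed
  \<comment> \<open>One Coxeter word records both images of g: its value under r and its
    permutation. This links the two homomorphisms without constructing a map out of the symmetric
    group.\<close>
  define lifts where "lifts g u \<longleftrightarrow> set u \<subseteq> {1..<n} \<and> r g = Q.gprod f u \<and> sg_perm n g = transps u"
    for g u
  have step: "\<exists>u. lifts (t \<otimes>\<^bsub>SG n\<^esub> g) u"
    if "1 \<le> i" "i < n" "t \<in> carrier (SG n)" "r t = f i" "sg_perm n t = transpose i (Suc i)"
      "g \<in> carrier (SG n)" "\<exists>u. lifts g u" for i t g
  proof -
    from that(7) obtain u where u: "set u \<subseteq> {1..<n}" "r g = Q.gprod f u" "sg_perm n g = transps u"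
      by (auto simp: lifts_def)
    have "lifts (t \<otimes>\<^bsub>SG n\<^esub> g) (i # u)"
      unfolding lifts_def using that(1-6) u by (simp add: sym_group_mult)
    then show ?thesis ..
  qed
  have f_inv: "inv\<^bsub>Q\<^esub> f i = f i" if "1 \<le> i" "i < n" for i
    using that f sq by (intro Q.inv_equality) auto
  have tr_inv: "inv\<^bsub>sym_group n\<^esub> (transpose i (Suc i)) = transpose i (Suc i)" if "1 \<le> i" "i < n" for i
  proof -
    have "transpose i (Suc i) = sg_perm n (sg_s n i)"
      using that by (simp add: sg_perm_gens)
    then have "transpose i (Suc i) \<in> carrier (sym_group n)"
      using that by simp
    then show ?thesis
      by (intro P.H.inv_equality) (simp_all add: sym_group_mult sym_group_one)
  qed
  have s: "r (sg_s n i) = f i" "sg_perm n (sg_s n i) = transpose i (Suc i)"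
    "sg_s n i \<in> carrier (SG n)" if "1 \<le> i" "i < n" for i
    using that by (simp_all add: f_def sg_perm_gens)
  have t: "r (sg_elem n (\<tau> i)) = f i" "sg_perm n (sg_elem n (\<tau> i)) = transpose i (Suc i)"
    "sg_elem n (\<tau> i) \<in> carrier (SG n)" if i: "1 \<le> i" "i < n" for i
  proof -
    have e: "sg_d n False i \<in> carrier (SG n)"
      by (rule S.d_closed[OF i])
    have "r (sg_elem n (\<tau> i)) = r (sg_d n False i) \<otimes>\<^bsub>Q\<^esub> inv\<^bsub>Q\<^esub> f i"
      unfolding sg_tau_eq[OF i] using e i by (simp add: f_def del: append.simps)
    then show "r (sg_elem n (\<tau> i)) = f i"
      unfolding triv[OF i] f_inv[OF i] using i f by (simp add: Pi_iff)
  qed (use i in \<open>simp_all add: sg_perm_gens sg_tau_closed\<close>)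
  have main: "\<exists>u. lifts g u" if "g \<in> carrier (SG n)" for g
    using that
  proof (induction rule: SG_induct)
    case one
    show ?case
      by (intro exI[of _ "[]"]) (simp add: lifts_def sym_group_one P.hom_one)
  next
    case (sigma i g)
    then show ?case using s[of i] by (intro step[of i]) auto
  next
    case (sigma_inv i g)
    then show ?case using s[of i] f_inv[of i] tr_inv[of i] by (intro step[of i]) auto
  next
    case (tau i g)
    then show ?case using t[of i] by (intro step[of i]) auto
  next
    case (tau_inv i g)
    then show ?case using t[of i] f_inv[of i] tr_inv[of i] by (intro step[of i]) auto
  qed
  have "g \<in> carrier (SG n)" "sg_perm n g = id"
    using g by (auto simp: kernel_def sym_group_one)
  then obtain u where u: "set u \<subseteq> {1..<n}" "r g = Q.gprod f u" "transps u = id"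
    using main by (metis lifts_def)
  have "Q.gprod f u = Q.gprod f []"
  proof (rule Q.gprod_cox_eq[OF f sq])
    show "cox_eq n u []" by (rule cox_eq_Nil_if_transps[OF u(1,3)])
    show "f i \<otimes>\<^bsub>Q\<^esub> f j = f j \<otimes>\<^bsub>Q\<^esub> f i" if "1 \<le> i" "i + 2 \<le> j" "j < n" for i j
      using S.far_ss[OF that] that by (simp add: f_def S.com_def flip: r.hom_mult)
    show "f i \<otimes>\<^bsub>Q\<^esub> (f (Suc i) \<otimes>\<^bsub>Q\<^esub> f i) = f (Suc i) \<otimes>\<^bsub>Q\<^esub> (f i \<otimes>\<^bsub>Q\<^esub> f (Suc i))"
      if "1 \<le> i" "Suc i < n" for i
      using S.braid[OF that] that by (simp add: f_def flip: r.hom_mult)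
  qed
  then show ?thesis
    using u(2) by simp
qed

text \<open>\<open>hom_trivial_on_ker\<close> is applied to the quotient map by the subgroup
  generated by all a_ij and b_ij.\<close>

lemma ker_subset_sp_sub: "sp_ker n \<subseteq> sp_sub n"
proof
  interpret S: group "SG n" by (rule group_SG)
  interpret N: normal "sp_sub n" "SG n" by (rule sp_sub_normal)
  fix g assume g: "g \<in> sp_ker n"
  have "sp_sub n #>\<^bsub>SG n\<^esub> g = \<one>\<^bsub>SG n Mod sp_sub n\<^esub>"
  proof (rule hom_trivial_on_ker[OF N.factorgroup_is_group N.r_coset_hom_Mod _ g])
    show "sp_sub n #>\<^bsub>SG n\<^esub> sg_d n u i = \<one>\<^bsub>SG n Mod sp_sub n\<^esub>" if "1 \<le> i" "i < n" for i u
      using N.rcos_const[OF S.is_group sg_d_sp_sub[OF that]] by (simp add: FactGroup_def)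
  qed
  then show "g \<in> sp_sub n"
    using g S.rcos_self[OF _ N.subgroup_axioms, of g] by (simp add: FactGroup_def kernel_def)
qed

theorem theorem3p1:
  fixes n :: nat
  assumes "n \<ge> 2"
  shows "carrier (SP n) = generate (SP n) (sp_elem n ` sp_gens n)
    \<and> has_presentation (SP n) (sp_gens n) (sp_elem n) (sp_rels n)"
proof -
  interpret S: group "SG n" by (rule group_SG)
  interpret SP: group "SP n" by (rule group_SP)
  have sub: "subgroup (sp_ker n) (SG n)"
    by (rule group_hom.subgroup_kernel[OF group_hom_sg_perm])
  have ker: "sp_ker n = sp_sub n"
    using sp_sub_subset_ker ker_subset_sp_sub by blast
  have carrier_SP: "carrier (SP n) = sp_ker n"
    by (simp add: SP_def)
  have "generate (SP n) (sp_elem n ` sp_gens n) = sp_sub n"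
    unfolding SP_def by (rule S.generate_consistent[OF _ sub]) (use sp_elem_ker in blast)
  then have gen: "carrier (SP n) = generate (SP n) (sp_elem n ` sp_gens n)"
    by (simp only: carrier_SP ker)
  have closed: "sp_elem n \<in> sp_gens n \<rightarrow> carrier (SP n)"
    using sp_elem_ker by (auto simp: carrier_SP)
  \<comment> \<open>The inclusion as a homomorphism transfers word evaluations from the kernel to
    SG_n, where the commutation list is available.\<close>
  have incl: "(\<lambda>g. g) \<in> hom (SP n) (SG n)"
    by (auto simp: hom_def SP_def kernel_def)
  have rels: "weval (SP n) (sp_elem n) p = weval (SP n) (sp_elem n) q" if "(p, q) \<in> sp_rels n" for p q
  proof -
    interpret F: sp_family "SG n" n "braid_family.pure (SG n) n (sg_s n) (sg_d n)"
      by (rule sp_family_SG)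
    have "weval (SP n) (sp_elem n) w =
        weval (SG n) (sp_val (braid_family.pure (SG n) n (sg_s n) (sg_d n))) w"
      if "w \<in> words (sp_gens n)" for w
    proof -
      have "weval (SP n) (sp_elem n) w = weval (SG n) (sp_elem n) w"
        by (rule hom_weval[OF group_SP group_SG incl closed that])
      also have "\<dots> = weval (SG n) (sp_val (braid_family.pure (SG n) n (sg_s n) (sg_d n))) w"
      proof (rule weval_cong[OF _ that])
        show "sp_elem n z = sp_val (braid_family.pure (SG n) n (sg_s n) (sg_d n)) z"
          if z: "z \<in> sp_gens n" for z
        proof -
          obtain u p q where pq: "ix n p q" "z = sp_gen_of u p q"
            using z by (rule sp_gens_cases)
          show ?thesis
            unfolding pq(2) sp_val_sp_gen_of by (rule sp_elem_eq_pure[OF pq(1)])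
        qed
      qed
      finally show ?thesis .
    qed
    then show ?thesis
      using F.weval_rels[OF that] sp_rels_words[OF that] by simp
  qed
  define \<phi> where "\<phi> = pres_lift (SP n) (sp_elem n)"
  have \<phi>: "\<phi> \<in> hom (sp_pres n) (SP n)"
    unfolding \<phi>_def by (rule SP.pres_lift(2)[OF closed rels])
  have \<phi>_gen: "\<phi> (wgen (sp_gens n) (sp_rels n) z) = sp_elem n z" if "z \<in> sp_gens n" for z
    unfolding \<phi>_def using closed rels that by (rule SP.pres_lift(3))
  interpret \<phi>: group_hom "sp_pres n" "SP n" \<phi>
    using \<phi> by (simp add: group_hom_def group_hom_axioms_def group_presented_group group_SP)
  \<comment> \<open>The map is regarded as taking values in SG_n, because the action on states is
    defined on the whole singular braid group.\<close>
  have "inj_on \<phi> (carrier (sp_pres n))"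
  proof (rule lift_SG_inj)
    show "\<phi> \<in> hom (sp_pres n) (SG n)"
      using \<phi> by (auto simp: hom_def SP_def kernel_def Pi_iff)
    show "\<phi> (pgen n u p q) = sp_elem n (sp_gen_of u p q)" if "ix n p q" for u p q
      using \<phi>_gen[of "sp_gen_of u p q"] that by (simp add: pgen_def)
  qed
  moreover have "carrier (SP n) \<subseteq> \<phi> ` carrier (sp_pres n)"
  proof -
    have "sp_elem n ` sp_gens n \<subseteq> \<phi> ` carrier (sp_pres n)"
      using \<phi>_gen wgen_closed[of "sp_gens n" "sp_rels n"] by (force simp: Pi_iff)
    then show ?thesis
      unfolding gen using SP.generate_subgroup_incl[OF _ \<phi>.img_is_subgroup] by blast
  qed
  ultimately have "\<phi> \<in> iso (sp_pres n) (SP n)"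
    using \<phi> by (auto simp: iso_def bij_betw_def)
  then show ?thesis
    using gen \<phi>_gen group_SP by (auto simp: has_presentation_def)
qed

end
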